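(* Let $f$ be a constant Gaussian curvature surface in $\mathbb{H}^3$ with $K>-1$ and $K\neq0$, let $f^{\lambda}$ denote its associated family and $n^\lambda$ the corresponding family of unit normals, and let $L^\lambda=f^\lambda\wedge n^\lambda$ be the family of Lagrangian harmonic Gauss maps, extended to $\lambda\in\mathbb{C}^\times$. Let $\bar{\mathbb{D}}=\{\lambda\in\mathbb{C}: |\lambda|\le1\}$. Then: (1) Assume $-1<K<0$ and take a constant $\lambda_0\in\mathbb{C}\setminus\bar{\mathbb{D}}$ with $|\lambda_0|=\exp\big(\operatorname{arcosh}\sqrt{-1/K}\big)$. Then $L^{\lambda}|_{\lambda=\lambda_0}$ is a harmonic local diffeomorphism into $\mathbb{H}^2$ up to conjugation (by a constant element of $\mathrm{SL}_2\mathbb{C}$). (2) Assume $K>0$ and take a constant $\lambda_0\in\mathbb{C}\setminus\bar{\mathbb{D}}$ with $|\lambda_0|=\exp\big(\operatorname{arsinh}\sqrt{1/K}\big)$. Then $L^{\lambda}|_{\lambda=\lambda_0}$ is a harmonic local diffeomorphism into $\mathbb{S}^2$ up to conjugation (by a constant element of $\mathrm{SL}_2\mathbb{C}$). Moreover, if the surface $f^\lambda$ is not totally umbilic, the harmonic Lagrangian Gauss map $L^{\lambda}|_{\lambda=\lambda_0}$ is non-conformal.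
   Context: Ambient space. $\mathbb{E}^{1,3}$ (metric $-\mathrm{d}x_0^2+\mathrm{d}x_1^2+\mathrm{d}x_2^2+\mathrm{d}x_3^2$, denoted $\langle\cdot,\cdot\rangle$) is identified with $2\times2$ Hermitian matrices via the orthonormal basis $e_0=\mathrm{id}$, $e_1=\begin{pmatrix}1&0\\0&-1\end{pmatrix}$, $e_2=\begin{pmatrix}0&-i\\i&0\end{pmatrix}$, $e_3=\begin{pmatrix}0&1\\1&0\end{pmatrix}$; $\mathbb{H}^3=\{\xi:\det\xi=1,\mathrm{tr}\,\xi>0\}$; $\mathrm{SL}_2\mathbb{C}$ acts by $\xi\mapsto g\xi g^*$, $g^*={}^t\bar g$. Put $\hat e_2=\begin{pmatrix}0&i\\0&0\end{pmatrix}$, $\hat e_3=\begin{pmatrix}0&0\\-i&0\end{pmatrix}$. Surfaces. A surface $f$ is an immersion of a connected 2-manifold $M$ with unit normal $n$ (tangent to $\mathbb{H}^3$); $\mathrm{I}=\langle \mathrm{d}f,\mathrm{d}f\rangle$, $\mathrm{I\!I}=-\langle \mathrm{d}f,\mathrm{d}n\rangle$, $K=-1+\det(\mathrm{I}^{-1}\mathrm{I\!I})$. For $K>-1$ choose $n$ so that $\mathrm{I\!I}$ is positive definite, write $K=-1+\sigma^2$ with $\sigma>0$, orient $M$ by $n$ (so that, for a positively oriented coordinate $z=x+iy$, $(f,n,f_x,f_y)$ has the same orientation as $(e_0,e_1,e_2,e_3)$), and let $z$ be a conformal coordinate for $\mathrm{I\!I}$ on a simply connected domain $D\subset M$. Then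 there are a complex function $Q$ (with $Q\,\mathrm{d}z^2=\langle\partial f,\partial f\rangle\mathrm{d}z^2$ the Klotz differential) and a real function $u$ with $e^{2u}>|Q|^2$ and $$\mathrm{I}=Q\,\mathrm{d}z^2+(e^u+|Q|^2e^{-u})\mathrm{d}z\mathrm{d}\bar z+\bar Q\,\mathrm{d}\bar z^2,\qquad \mathrm{I\!I}=\sigma(e^u-|Q|^2e^{-u})\mathrm{d}z\mathrm{d}\bar z.$$ If $K$ is constant, $Q$ is holomorphic. Associated family. For constant $K>-1$ and $\lambda\in\mathbb{C}^\times$ let $$U^\lambda=\tfrac14\partial u\,e_1+\tfrac{1+\sigma}{2}\lambda^{-1}(e^{u/2}\hat e_2+Qe^{-u/2}\hat e_3),\quad V^\lambda=-\tfrac14\bar\partial u\,e_1+\tfrac{1-\sigma}{2}\lambda(\bar Qe^{-u/2}\hat e_2+e^{u/2}\hat e_3),$$ and let the extended frame $\Psi^\lambda:D\to\mathrm{SL}_2\mathbb{C}$ be the solution of $(\Psi^\lambda)^{-1}\mathrm{d}\Psi^\lambda=U^\lambda\mathrm{d}z+V^\lambda\mathrm{d}\bar z$, $\Psi^\lambda(z_* )=\mathrm{id}$ at a base point $z_*\in D$. For $\lambda\in\mathbb{S}^1$ the associated family is $f^\lambda=\Psi^\lambda e_0(\Psi^\lambda)^*$ with unit normals $n^\lambda=\Psi^\lambda e_1(\Psi^\lambda)^*$; $f^\lambda|_{\lambda=1}$ equals $f$ up to rigid motion. The maps $f^\lambda,n^\lambda,L^\lambda$ are considered on $D$. Lagrangian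 Gauss map. The oriented timelike plane $f^\lambda\wedge n^\lambda$ is a point of $\mathrm{Geo}(\mathbb{H}^3)=\mathrm{SL}_2\mathbb{C}/\mathrm{GL}_1\mathbb{C}$, $\mathrm{GL}_1\mathbb{C}=\{\mathrm{diag}(a,a^{-1})\}$, the space of oriented geodesics of $\mathbb{H}^3$; this space is identified with the adjoint orbit of $ie_1$, and $L^\lambda$ is represented, for all $\lambda\in\mathbb{C}^\times$, by $L^\lambda=i\Psi^\lambda e_1(\Psi^\lambda)^{-1}$. $\mathbb{H}^2$ and $\mathbb{S}^2$. $\mathbb{H}^2=\mathrm{SU}_{1,1}/\mathrm{U}_1$ is identified with $\{i g e_1 g^{-1}: g\in\mathrm{SU}_{1,1}\}\subset\mathfrak{su}_{1,1}$, metric induced by $\frac12\mathrm{tr}(AB)$; $\mathbb{S}^2=\mathrm{SU}_2/\mathrm{U}_1$ with $\{i g e_1 g^{-1}: g\in\mathrm{SU}_{2}\}\subset\mathfrak{su}_{2}$, metric induced by $-\frac12\mathrm{tr}(AB)$. Here $\mathrm{SU}_{1,1}=\{g\in\mathrm{SL}_2\mathbb{C}: e_1(g^* )^{-1}e_1=g\}$. "Into $\mathbb{H}^2$ (resp. $\mathbb{S}^2$) up to conjugation" means that $h L^{\lambda_0}h^{-1}$ takes values there for some constant $h\in\mathrm{SL}_2\mathbb{C}$. Harmonicity is with respect to the conformal structure of $\mathrm{I\!I}$. A map $L$ is non-conformal if $\langle\partial L,\partial L\rangle$ is not identically zero. A surface is totally umbilic iff $Q\equiv0$. *)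

theory Defs
  imports "HOL-Analysis.Analysis"
begin

type_synonym cmat = "complex^2^2"

primrec ck_on ::
    "nat \<Rightarrow> 'a::real_normed_vector set \<Rightarrow> ('a \<Rightarrow> 'b::real_normed_vector) \<Rightarrow> bool" where
  "ck_on 0 S f \<longleftrightarrow> continuous_on S f"
| "ck_on (Suc k) S f \<longleftrightarrow> (\<forall>x\<in>S. f differentiable (at x)) \<and>
     (\<forall>v. ck_on k S (\<lambda>x. frechet_derivative f (at x) v))"

text \<open>Intended for open \<open>S\<close> in a finite-dimensional space, where this is the class
  \<open>C\<^sup>\<infinity>\<close>.\<close>

definition smooth_on ::
    "'a::real_normed_vector set \<Rightarrow> ('a \<Rightarrow> 'b::real_normed_vector) \<Rightarrow> bool" where
  "smooth_on S f \<longleftrightarrow> (\<forall>k. ck_on k S f)"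

definition dx :: "(complex \<Rightarrow> 'b::real_normed_vector) \<Rightarrow> complex \<Rightarrow> 'b" where
  "dx f z = frechet_derivative f (at z) 1"

definition dy :: "(complex \<Rightarrow> 'b::real_normed_vector) \<Rightarrow> complex \<Rightarrow> 'b" where
  "dy f z = frechet_derivative f (at z) \<i>"

definition laplacian :: "(complex \<Rightarrow> 'b::real_normed_vector) \<Rightarrow> complex \<Rightarrow> 'b" where
  "laplacian f z = dx (dx f) z + dy (dy f) z"

text \<open>The library has no complex scalar multiplication on \<^typ>\<open>complex^2^2\<close>.\<close>

definition cscale :: "complex \<Rightarrow> cmat \<Rightarrow> cmat"  (infixr "*\<^sub>C" 75) where
  "c *\<^sub>C A = (\<chi> i j. c * A $ i $ j)"

definition d_z :: "(complex \<Rightarrow> cmat) \<Rightarrow> complex \<Rightarrow> cmat" where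
  "d_z f z = (1/2) *\<^sub>C (dx f z - \<i> *\<^sub>C dy f z)"

definition du_z :: "(complex \<Rightarrow> real) \<Rightarrow> complex \<Rightarrow> complex" where
  "du_z u z = (of_real (dx u z) - \<i> * of_real (dy u z)) / 2"

definition du_zbar :: "(complex \<Rightarrow> real) \<Rightarrow> complex \<Rightarrow> complex" where
  "du_zbar u z = (of_real (dx u z) + \<i> * of_real (dy u z)) / 2"

definition e0 :: cmat where "e0 = mat 1"
definition e1 :: cmat where "e1 = vector [vector [1, 0], vector [0, -1]]"
definition e2 :: cmat where "e2 = vector [vector [0, -\<i>], vector [\<i>, 0]]"
definition e3 :: cmat where "e3 = vector [vector [0, 1], vector [1, 0]]"
definition eh2 :: cmat where "eh2 = vector [vector [0, \<i>], vector [0, 0]]"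
definition eh3 :: cmat where "eh3 = vector [vector [0, 0], vector [-\<i>, 0]]"

definition ctransp :: "cmat \<Rightarrow> cmat" where
  "ctransp A = (\<chi> i j. cnj (A $ j $ i))"

definition hermitian :: "cmat \<Rightarrow> bool" where
  "hermitian A \<longleftrightarrow> ctransp A = A"

text \<open>The coefficient of \<open>X\<close> at a basis vector \<open>e \<in> {e0, e1, e2, e3}\<close>, see
  \<open>coord_expansion\<close> below; it is real if \<open>X\<close> is Hermitian.\<close>

definition coord :: "cmat \<Rightarrow> cmat \<Rightarrow> complex" where
  "coord e X = trace (e ** X) / 2"

text \<open>The Lorentz metric, extended complex bilinearly to all complex matrices.\<close>

definition mink :: "cmat \<Rightarrow> cmat \<Rightarrow> complex" where
  "mink X Y = - coord e0 X * coord e0 Y + coord e1 X * coord e1 Y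
              + coord e2 X * coord e2 Y + coord e3 X * coord e3 Y"

lemma coord_expansion:
  "X = coord e0 X *\<^sub>C e0 + coord e1 X *\<^sub>C e1 + coord e2 X *\<^sub>C e2 + coord e3 X *\<^sub>C e3"
  by (simp add: vec_eq_iff forall_2 cscale_def coord_def trace_def sum_2 e0_def e1_def e2_def
      e3_def mat_def matrix_matrix_mult_def field_simps)

lemma mink_self: "mink X X = - det X"
  by (simp add: mink_def coord_def trace_def sum_2 e0_def e1_def e2_def e3_def mat_def
      matrix_matrix_mult_def det_2 field_simps power2_eq_square)

definition coords :: "cmat \<Rightarrow> real^4" where
  "coords X = vector [Re (coord e0 X), Re (coord e1 X), Re (coord e2 X), Re (coord e3 X)]"

lemma coords_basis:
  "coords e0 = axis 1 1" "coords e1 = axis 2 1" "coords e2 = axis 3 1" "coords e3 = axis 4 1"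
  by (simp_all add: coords_def vec_eq_iff forall_4 axis_def vector_def coord_def trace_def sum_2
      e0_def e1_def e2_def e3_def mat_def matrix_matrix_mult_def)

definition H3 :: "cmat set" where
  "H3 = {X. hermitian X \<and> det X = 1 \<and> Re (trace X) > 0}"

definition fff :: "(complex \<Rightarrow> cmat) \<Rightarrow> complex \<Rightarrow> complex \<Rightarrow> complex \<Rightarrow> real" where
  "fff f z v w =
     Re (mink (frechet_derivative f (at z) v) (frechet_derivative f (at z) w))"

definition sff :: "(complex \<Rightarrow> cmat) \<Rightarrow> (complex \<Rightarrow> cmat) \<Rightarrow>
    complex \<Rightarrow> complex \<Rightarrow> complex \<Rightarrow> real" where
  "sff f n z v w =
     - Re (mink (frechet_derivative f (at z) v) (frechet_derivative n (at z) w))"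

definition gram :: "(complex \<Rightarrow> complex \<Rightarrow> real) \<Rightarrow> real^2^2" where
  "gram b = vector [vector [b 1 1, b 1 \<i>], vector [b \<i> 1, b \<i> \<i>]]"

definition gauss_curvature ::
    "(complex \<Rightarrow> cmat) \<Rightarrow> (complex \<Rightarrow> cmat) \<Rightarrow> complex \<Rightarrow> real" where
  "gauss_curvature f n z = -1 + det (matrix_inv (gram (fff f z)) ** gram (sff f n z))"

definition surface_in_H3 ::
    "complex set \<Rightarrow> (complex \<Rightarrow> cmat) \<Rightarrow> (complex \<Rightarrow> cmat) \<Rightarrow> bool" where
  "surface_in_H3 D f n \<longleftrightarrow>
     smooth_on D f \<and> smooth_on D n \<and>
     (\<forall>z\<in>D. f z \<in> H3 \<and> inj (frechet_derivative f (at z)) \<and>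
        hermitian (n z) \<and> mink (n z) (n z) = 1 \<and> mink (f z) (n z) = 0 \<and>
        (\<forall>v. mink (frechet_derivative f (at z) v) (n z) = 0))"

definition positively_oriented ::
    "complex set \<Rightarrow> (complex \<Rightarrow> cmat) \<Rightarrow> (complex \<Rightarrow> cmat) \<Rightarrow> bool" where
  "positively_oriented D f n \<longleftrightarrow>
     (\<forall>z\<in>D. det (vector [coords (f z), coords (n z), coords (dx f z), coords (dy f z)]
                   :: real^4^4) > 0)"

text \<open>The factor \<open>\<rho>\<close> is positive, so this includes positive definiteness, i.e. the choice of
  the sign of the normal.\<close>

definition sff_conformal ::
    "complex set \<Rightarrow> (complex \<Rightarrow> cmat) \<Rightarrow> (complex \<Rightarrow> cmat) \<Rightarrow> bool" where
  "sff_conformal D f n \<longleftrightarrow> (\<forall>z\<in>D. \<exists>\<rho>>0. \<forall>v w. sff f n z v w = \<rho> * (v \<bullet> w))"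

text \<open>\<open>Q\<close> and \<open>u\<close> are uniquely determined by these conditions: \<open>Q\<close> by the first fundamental
  form, and then \<open>exp u\<close> as half the sum of the \<open>dz dzbar\<close>-coefficients of the first and of
  \<open>1/\<sigma>\<close> times the second fundamental form. The forms are
  evaluated on a tangent vector \<open>v\<close>, where \<open>dz\<close> is \<open>v\<close> and \<open>dzbar\<close> is \<open>cnj v\<close>.\<close>

definition klotz_data :: "complex set \<Rightarrow> (complex \<Rightarrow> cmat) \<Rightarrow> (complex \<Rightarrow> cmat) \<Rightarrow>
    real \<Rightarrow> (complex \<Rightarrow> complex) \<Rightarrow> (complex \<Rightarrow> real) \<Rightarrow> bool" where
  "klotz_data D f n \<sigma> Q u \<longleftrightarrow>
     (\<forall>z\<in>D. Q z = mink (d_z f z) (d_z f z) \<and> exp (2 * u z) > (cmod (Q z))\<^sup>2 \<and>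
       (\<forall>v. of_real (fff f z v v) =
              Q z * v\<^sup>2 + of_real (exp (u z) + (cmod (Q z))\<^sup>2 * exp (- u z)) * (v * cnj v)
              + cnj (Q z) * (cnj v)\<^sup>2 \<and>
            of_real (sff f n z v v) =
              of_real (\<sigma> * (exp (u z) - (cmod (Q z))\<^sup>2 * exp (- u z))) * (v * cnj v)))"

definition totally_umbilic ::
    "complex set \<Rightarrow> (complex \<Rightarrow> cmat) \<Rightarrow> (complex \<Rightarrow> cmat) \<Rightarrow> bool" where
  "totally_umbilic D f n \<longleftrightarrow> (\<forall>z\<in>D. \<exists>c. \<forall>v w. sff f n z v w = c * fff f z v w)"

definition U_form :: "real \<Rightarrow> (complex \<Rightarrow> complex) \<Rightarrow> (complex \<Rightarrow> real) \<Rightarrow>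
    complex \<Rightarrow> complex \<Rightarrow> cmat" where
  "U_form \<sigma> Q u lam z =
     (du_z u z / 4) *\<^sub>C e1 +
     (of_real ((1 + \<sigma>) / 2) * inverse lam) *\<^sub>C
       (of_real (exp (u z / 2)) *\<^sub>C eh2 + (Q z * of_real (exp (- u z / 2))) *\<^sub>C eh3)"

definition V_form :: "real \<Rightarrow> (complex \<Rightarrow> complex) \<Rightarrow> (complex \<Rightarrow> real) \<Rightarrow>
    complex \<Rightarrow> complex \<Rightarrow> cmat" where
  "V_form \<sigma> Q u lam z =
     (- du_zbar u z / 4) *\<^sub>C e1 +
     (of_real ((1 - \<sigma>) / 2) * lam) *\<^sub>C
       ((cnj (Q z) * of_real (exp (- u z / 2))) *\<^sub>C eh2 + of_real (exp (u z / 2)) *\<^sub>C eh3)"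

definition SL2C :: "cmat set" where
  "SL2C = {g. det g = 1}"

definition extended_frame :: "complex set \<Rightarrow> complex \<Rightarrow> real \<Rightarrow> (complex \<Rightarrow> complex) \<Rightarrow>
    (complex \<Rightarrow> real) \<Rightarrow> (complex \<Rightarrow> complex \<Rightarrow> cmat) \<Rightarrow> bool" where
  "extended_frame D zb \<sigma> Q u \<Psi> \<longleftrightarrow>
     (\<forall>lam. lam \<noteq> 0 \<longrightarrow> \<Psi> lam zb = mat 1 \<and>
       (\<forall>z\<in>D. \<Psi> lam z \<in> SL2C \<and> \<Psi> lam differentiable (at z) \<and>
         (\<forall>v. matrix_inv (\<Psi> lam z) ** frechet_derivative (\<Psi> lam) (at z) v =
              v *\<^sub>C U_form \<sigma> Q u lam z + cnj v *\<^sub>C V_form \<sigma> Q u lam z)))"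

definition assoc_surface ::
    "(complex \<Rightarrow> complex \<Rightarrow> cmat) \<Rightarrow> complex \<Rightarrow> complex \<Rightarrow> cmat" where
  "assoc_surface \<Psi> lam z = \<Psi> lam z ** e0 ** ctransp (\<Psi> lam z)"

definition assoc_normal ::
    "(complex \<Rightarrow> complex \<Rightarrow> cmat) \<Rightarrow> complex \<Rightarrow> complex \<Rightarrow> cmat" where
  "assoc_normal \<Psi> lam z = \<Psi> lam z ** e1 ** ctransp (\<Psi> lam z)"

text \<open>For \<open>|lam| = 1\<close> the oriented geodesic spanned by \<open>f = \<Psi> e0 \<Psi>\<^sup>*\<close> and \<open>n = \<Psi> e1 \<Psi>\<^sup>*\<close> is the coset of
  \<open>\<Psi>\<close> modulo diagonal matrices, represented in the adjoint orbit of \<open>i e1\<close>; the same formula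
  is used for all nonzero \<open>lam\<close>.\<close>

definition gauss_map ::
    "(complex \<Rightarrow> complex \<Rightarrow> cmat) \<Rightarrow> complex \<Rightarrow> complex \<Rightarrow> cmat" where
  "gauss_map \<Psi> lam z = \<i> *\<^sub>C (\<Psi> lam z ** e1 ** matrix_inv (\<Psi> lam z))"


lemma matrix_inv_cancel:
  fixes A :: "'a::field^'n^'n"
  assumes "det A \<noteq> 0"
  shows "A ** matrix_inv A = mat 1" and "matrix_inv A ** A = mat 1"
proof -
  have "\<exists>B. A ** B = mat 1 \<and> B ** A = mat 1"
    using assms by (simp add: invertible_det_nz[symmetric] invertible_def)
  then have "A ** matrix_inv A = mat 1 \<and> matrix_inv A ** A = mat 1"
    unfolding matrix_inv_def by (rule someI_ex)
  then show "A ** matrix_inv A = mat 1" and "matrix_inv A ** A = mat 1" by auto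
qed

lemma gauss_map_eq_normal_surface:
  assumes "\<Psi> lam z \<in> SL2C"
  shows "gauss_map \<Psi> lam z =
    \<i> *\<^sub>C (assoc_normal \<Psi> lam z ** matrix_inv (assoc_surface \<Psi> lam z))"
proof -
  let ?g = "\<Psi> lam z"
  let ?h = "ctransp ?g"
  let ?f = "?g ** ?h"
  have "det ?h = cnj (det ?g)"
    by (simp add: det_2 ctransp_def mult.commute)
  then have g: "det ?g \<noteq> 0" and f: "det ?f \<noteq> 0"
    using assms by (simp_all add: SL2C_def det_mul)
  have "?h ** matrix_inv ?f = (matrix_inv ?g ** ?g) ** (?h ** matrix_inv ?f)"
    by (simp add: matrix_inv_cancel[OF g])
  also have "\<dots> = matrix_inv ?g ** (?f ** matrix_inv ?f)"
    by (simp add: matrix_mul_assoc)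
  finally have "?h ** matrix_inv ?f = matrix_inv ?g"
    by (simp add: matrix_inv_cancel[OF f])
  then show ?thesis
    by (simp add: gauss_map_def assoc_normal_def assoc_surface_def e0_def
        matrix_mul_assoc[symmetric])
qed

definition SU11 :: "cmat set" where
  "SU11 = {g \<in> SL2C. e1 ** matrix_inv (ctransp g) ** e1 = g}"

definition SU2 :: "cmat set" where
  "SU2 = {g \<in> SL2C. matrix_inv (ctransp g) = g}"

definition H2 :: "cmat set" where
  "H2 = (\<lambda>g. \<i> *\<^sub>C (g ** e1 ** matrix_inv g)) ` SU11"

definition S2 :: "cmat set" where
  "S2 = (\<lambda>g. \<i> *\<^sub>C (g ** e1 ** matrix_inv g)) ` SU2"

text \<open>Complex bilinear extensions of the forms inducing the metrics of \<open>H2\<close> and \<open>S2\<close>.\<close>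

definition H2_form :: "cmat \<Rightarrow> cmat \<Rightarrow> complex" where
  "H2_form A B = trace (A ** B) / 2"

definition S2_form :: "cmat \<Rightarrow> cmat \<Rightarrow> complex" where
  "S2_form A B = - trace (A ** B) / 2"

definition tangent_space :: "cmat set \<Rightarrow> cmat \<Rightarrow> cmat set" where
  "tangent_space N p =
     {v. \<exists>\<gamma>. \<gamma> (0::real) = p \<and> (\<forall>t. \<gamma> t \<in> N) \<and> (\<gamma> has_vector_derivative v) (at 0)}"

text \<open>Harmonic maps from a plane domain into a submanifold \<open>N\<close> of a vector space, \<open>N\<close> carrying
  the metric induced by the flat form \<open>B\<close>. The Levi-Civita connection of \<open>N\<close> is the tangential
  part of the flat derivative, so the tension field is the tangential part of the Laplacian (up
  to a positive factor for any metric in the conformal class of the coordinate), and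
  it vanishes iff the Laplacian is \<open>B\<close>-orthogonal to the tangent space.\<close>

definition harmonic_into :: "complex set \<Rightarrow> cmat set \<Rightarrow> (cmat \<Rightarrow> cmat \<Rightarrow> complex) \<Rightarrow>
    (complex \<Rightarrow> cmat) \<Rightarrow> bool" where
  "harmonic_into D N B L \<longleftrightarrow>
     smooth_on D L \<and> L ` D \<subseteq> N \<and>
     (\<forall>z\<in>D. \<forall>v \<in> tangent_space N (L z). B (laplacian L z) v = 0)"

text \<open>Every point of \<open>D\<close> has a neighbourhood \<open>W\<close> mapped bijectively onto a relatively open
  subset of the submanifold \<open>N\<close>, with smooth inverse; smoothness on \<open>N\<close> is expressed by a
  smooth extension \<open>G\<close> to the ambient space.\<close>

definition local_diffeo_into ::
    "complex set \<Rightarrow> cmat set \<Rightarrow> (complex \<Rightarrow> cmat) \<Rightarrow> bool" where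
  "local_diffeo_into D N L \<longleftrightarrow>
     smooth_on D L \<and> L ` D \<subseteq> N \<and>
     (\<forall>z\<in>D. \<exists>W Y G. open W \<and> z \<in> W \<and> W \<subseteq> D \<and> open Y \<and> L ` W = Y \<inter> N \<and>
        smooth_on Y (G :: cmat \<Rightarrow> complex) \<and> (\<forall>w\<in>W. G (L w) = w))"

definition non_conformal :: "complex set \<Rightarrow> (cmat \<Rightarrow> cmat \<Rightarrow> complex) \<Rightarrow>
    (complex \<Rightarrow> cmat) \<Rightarrow> bool" where
  "non_conformal D B L \<longleftrightarrow> (\<exists>z\<in>D. B (d_z L z) (d_z L z) \<noteq> 0)"

end

theory Submission
  imports Defs
begin

text \<open>The condition on \<open>|lam0|\<close> says \<open>(1 - \<sigma>) |lam0|\<^sup>2 = e (1 + \<sigma>)\<close> with \<open>e = 1\<close> if \<open>K < 0\<close> and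
  \<open>e = -1\<close> if \<open>K > 0\<close>. This is exactly the reality condition under which the Maurer-Cartan form
  of the extended frame takes values in \<open>su(1,1)\<close> respectively \<open>su(2)\<close>. Hence the frame itself stays in
  \<open>SU(1,1)\<close> respectively \<open>SU(2)\<close>, its Gauss map lies in \<open>H2\<close> respectively \<open>S2\<close>, and no conjugation is needed.
  Symmetry of the second derivatives of the frame gives the Maurer-Cartan equation, which makes the
  Laplacian of the Gauss map a multiple of the Gauss map, so the map is harmonic. With off-diagonal
  entries \<open>\<beta>\<close>, \<open>\<gamma>\<close> of the \<open>dz\<close>-part, the differential of the Gauss map is essentially
  \<open>\<beta> dz + e cnj \<gamma> dzbar\<close>, which is invertible as \<open>|\<gamma>| < |\<beta>|\<close>, and its Hopf differential is
  \<open>\<beta> \<gamma>\<close> up to a constant, a nonzero multiple of \<open>Q\<close>.\<close>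

subsection \<open>Calculus of smooth maps\<close>

lemma frechet_derivative_eq:
  assumes "(f has_derivative f') (at x)"
  shows "frechet_derivative f (at x) = f'"
  using frechet_derivative_at[OF assms] by simp

lemma frechet_derivative_cong_open:
  assumes "open S" "x \<in> S" "\<And>y. y \<in> S \<Longrightarrow> f y = g y" "f differentiable (at x)"
  shows "frechet_derivative g (at x) = frechet_derivative f (at x)" "g differentiable (at x)"
proof -
  have "(f has_derivative frechet_derivative f (at x)) (at x)"
    using assms(4) frechet_derivative_works by blast
  then have "(g has_derivative frechet_derivative f (at x)) (at x)"
    by (rule has_derivative_transform_within_open[OF _ assms(1,2)]) (use assms(3) in auto)
  then show "frechet_derivative g (at x) = frechet_derivative f (at x)" "g differentiable (at x)"
    by (auto simp: frechet_derivative_eq differentiable_def)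
qed

lemma ck_on_cong:
  assumes "open S" "\<And>x. x \<in> S \<Longrightarrow> f x = g x" "ck_on k S f"
  shows "ck_on k S g"
  using assms(2,3)
proof (induction k arbitrary: f g)
  case 0
  then show ?case by (simp cong: continuous_on_cong)
next
  case (Suc k)
  then show ?case
    using frechet_derivative_cong_open[OF assms(1), of _ f g] by (auto intro: Suc.IH[rotated])
qed

text \<open>The recursive clause speaks of \<open>frechet_derivative\<close>; an explicit derivative
  agrees with it on the open set \<open>S\<close>, and \<open>ck_on_cong\<close> carries the
  agreement through all further derivatives.\<close>

lemma ck_on_SucI:
  assumes "open S" "\<And>x. x \<in> S \<Longrightarrow> (f has_derivative f' x) (at x)"
    and "\<And>v. ck_on k S (\<lambda>x. f' x v)"
  shows "ck_on (Suc k) S f"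
proof -
  have "ck_on k S (\<lambda>x. frechet_derivative f (at x) v)" for v
    by (rule ck_on_cong[OF assms(1) _ assms(3)[of v]]) (simp add: frechet_derivative_eq[OF assms(2)])
  then show ?thesis using assms(2) by (auto simp: differentiable_def)
qed

lemma ck_on_Suc_has_derivative:
  assumes "ck_on (Suc k) S f" "x \<in> S"
  shows "(f has_derivative frechet_derivative f (at x)) (at x)"
  using assms frechet_derivative_works by auto

lemma ck_on_Suc_imp_ck_on: "ck_on (Suc k) S f \<Longrightarrow> ck_on k S f"
proof (induction k arbitrary: f)
  case 0
  then show ?case
    by (simp add: differentiable_imp_continuous_on differentiable_at_imp_differentiable_on)
next
  case (Suc k)
  then show ?case by (metis ck_on.simps(2))
qed

lemma ck_on_const [simp]: "ck_on k S (\<lambda>x. c)"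
  by (induction k arbitrary: c) (auto simp: frechet_derivative_const)

lemma ck_on_linear:
  assumes "open S" "bounded_linear h" "ck_on k S f"
  shows "ck_on k S (\<lambda>x. h (f x))"
  using assms(3)
proof (induction k arbitrary: f)
  case 0
  then show ?case using bounded_linear.continuous_on[OF assms(2)] by auto
next
  case (Suc k)
  show ?case
  proof (rule ck_on_SucI[OF assms(1)])
    show "((\<lambda>x. h (f x)) has_derivative (\<lambda>v. h (frechet_derivative f (at x) v))) (at x)"
      if "x \<in> S" for x
      by (rule bounded_linear.has_derivative[OF assms(2) ck_on_Suc_has_derivative[OF Suc.prems that]])
    show "ck_on k S (\<lambda>x. h (frechet_derivative f (at x) v))" for v
      using Suc by auto
  qed
qed

lemma ck_on_add:
  assumes "open S" "ck_on k S f" "ck_on k S g"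
  shows "ck_on k S (\<lambda>x. f x + g x)"
  using assms(2,3)
proof (induction k arbitrary: f g)
  case 0
  then show ?case by (auto intro: continuous_on_add)
next
  case (Suc k)
  show ?case
  proof (rule ck_on_SucI[OF assms(1)])
    show "((\<lambda>x. f x + g x) has_derivative
        (\<lambda>v. frechet_derivative f (at x) v + frechet_derivative g (at x) v)) (at x)"
      if "x \<in> S" for x
      using Suc.prems that by (intro has_derivative_add ck_on_Suc_has_derivative)
    show "ck_on k S (\<lambda>x. frechet_derivative f (at x) v + frechet_derivative g (at x) v)" for v
      using Suc by auto
  qed
qed

text \<open>The product rule leaves \<open>f\<close> and \<open>g\<close> undifferentiated in one
  factor each, so the induction also uses that order \<open>Suc k\<close> implies order
  \<open>k\<close>.\<close>

lemma ck_on_bilinear: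
  assumes "open S" "bounded_bilinear h" "ck_on k S f" "ck_on k S g"
  shows "ck_on k S (\<lambda>x. h (f x) (g x))"
  using assms(3,4)
proof (induction k arbitrary: f g)
  case 0
  then show ?case using bounded_bilinear.continuous_on[OF assms(2)] by auto
next
  case (Suc k)
  show ?case
  proof (rule ck_on_SucI[OF assms(1)])
    show "((\<lambda>x. h (f x) (g x)) has_derivative
        (\<lambda>v. h (f x) (frechet_derivative g (at x) v) + h (frechet_derivative f (at x) v) (g x))) (at x)"
      if "x \<in> S" for x
      using Suc.prems that
      by (intro bounded_bilinear.FDERIV[OF assms(2)] ck_on_Suc_has_derivative)
    show "ck_on k S (\<lambda>x. h (f x) (frechet_derivative g (at x) v) +
        h (frechet_derivative f (at x) v) (g x))" for v
      using Suc.prems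
      by (intro ck_on_add[OF assms(1)] Suc.IH ck_on_Suc_imp_ck_on[OF Suc.prems(1)]
          ck_on_Suc_imp_ck_on[OF Suc.prems(2)]) auto
  qed
qed

lemma ck_on_sum:
  assumes "open S" "\<And>i. i \<in> I \<Longrightarrow> ck_on k S (f i)"
  shows "ck_on k S (\<lambda>x. \<Sum>i\<in>I. f i x)"
proof (cases "finite I")
  case True
  then show ?thesis using assms(2)
    by (induction I) (auto intro: ck_on_add[OF assms(1)])
qed simp

text \<open>The hypothesis on \<open>g\<close> controls its derivative in fixed directions, but the
  chain rule applies it in a direction that moves with \<open>x\<close>. Expanding that direction in
  the basis of the Euclidean middle space leaves a finite sum of products covered by the
  induction.\<close>

lemma ck_on_compose:
  fixes f :: "'a::real_normed_vector \<Rightarrow> 'b::euclidean_space"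
  assumes "open S" "open T" "ck_on k S f" "ck_on k T g" "f ` S \<subseteq> T"
  shows "ck_on k S (\<lambda>x. g (f x))"
  using assms(3,4)
proof (induction k arbitrary: g)
  case 0
  then show ?case using continuous_on_compose2[of T g S f] assms(5) by auto
next
  case (Suc k)
  show ?case
  proof (rule ck_on_SucI[OF assms(1)])
    fix x assume x: "x \<in> S"
    have g: "(g has_derivative frechet_derivative g (at (f x))) (at (f x))"
      using Suc.prems(2) x assms(5) ck_on_Suc_has_derivative by blast
    have "frechet_derivative g (at (f x)) y =
        (\<Sum>b\<in>Basis. (y \<bullet> b) *\<^sub>R frechet_derivative g (at (f x)) b)" for y
    proof -
      interpret linear "frechet_derivative g (at (f x))" by (rule has_derivative_linear[OF g])
      have "frechet_derivative g (at (f x)) (\<Sum>b\<in>Basis. (y \<bullet> b) *\<^sub>R b) =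
          (\<Sum>b\<in>Basis. (y \<bullet> b) *\<^sub>R frechet_derivative g (at (f x)) b)"
        by (simp add: sum scale)
      then show ?thesis by (simp add: euclidean_representation)
    qed
    then have "frechet_derivative g (at (f x)) =
        (\<lambda>y. \<Sum>b\<in>Basis. (y \<bullet> b) *\<^sub>R frechet_derivative g (at (f x)) b)"
      by (rule ext)
    from has_derivative_compose[OF ck_on_Suc_has_derivative[OF Suc.prems(1) x]
        has_derivative_eq_rhs[OF g this]]
    show "((\<lambda>x. g (f x)) has_derivative (\<lambda>v. \<Sum>b\<in>Basis.
        (frechet_derivative f (at x) v \<bullet> b) *\<^sub>R frechet_derivative g (at (f x)) b)) (at x)" .
  next
    fix v
    have "ck_on k S (\<lambda>x. frechet_derivative f (at x) v \<bullet> b)" for b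
      by (rule ck_on_linear[OF assms(1) bounded_linear_inner_left]) (use Suc.prems(1) in auto)
    moreover have "ck_on k S (\<lambda>x. frechet_derivative g (at (f x)) b)" for b
      by (rule Suc.IH[of "\<lambda>y. frechet_derivative g (at y) b"])
        (use Suc.prems ck_on_Suc_imp_ck_on in auto)
    ultimately show "ck_on k S (\<lambda>x. \<Sum>b\<in>Basis.
        (frechet_derivative f (at x) v \<bullet> b) *\<^sub>R frechet_derivative g (at (f x)) b)"
      by (intro ck_on_sum[OF assms(1)] ck_on_bilinear[OF assms(1) bounded_bilinear_scaleR])
  qed
qed

lemma ck_on_subset:
  "ck_on k S f \<Longrightarrow> T \<subseteq> S \<Longrightarrow> ck_on k T f"
  by (induction k arbitrary: f) (auto intro: continuous_on_subset)

lemma ck_on_id: "open S \<Longrightarrow> ck_on k S (\<lambda>x. x)"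
  by (cases k) (auto intro: ck_on_SucI[where f' = "\<lambda>_ v. v"] simp del: ck_on.simps(2))

lemma smooth_on_cong:
  "open S \<Longrightarrow> (\<And>x. x \<in> S \<Longrightarrow> f x = g x) \<Longrightarrow> smooth_on S f \<Longrightarrow> smooth_on S g"
  unfolding smooth_on_def by (meson ck_on_cong)

lemma smooth_on_subset: "smooth_on S f \<Longrightarrow> T \<subseteq> S \<Longrightarrow> smooth_on T f"
  unfolding smooth_on_def by (meson ck_on_subset)

lemma smooth_on_compose:
  fixes f :: "'a::real_normed_vector \<Rightarrow> 'b::euclidean_space"
  shows "open S \<Longrightarrow> open T \<Longrightarrow> smooth_on S f \<Longrightarrow> smooth_on T g \<Longrightarrow> f ` S \<subseteq> T \<Longrightarrow>
    smooth_on S (\<lambda>x. g (f x))"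
  unfolding smooth_on_def using ck_on_compose[of S T _ f g] by blast

lemma smooth_on_frechet_derivative:
  "smooth_on S f \<Longrightarrow> smooth_on S (\<lambda>x. frechet_derivative f (at x) v)"
  unfolding smooth_on_def using ck_on.simps(2)[of _ S f] by blast

lemma smooth_on_has_derivative:
  "smooth_on S f \<Longrightarrow> x \<in> S \<Longrightarrow> (f has_derivative frechet_derivative f (at x)) (at x)"
  unfolding smooth_on_def by (meson ck_on_Suc_has_derivative)

lemma smooth_on_continuous_on: "smooth_on S f \<Longrightarrow> continuous_on S f"
  unfolding smooth_on_def by (metis ck_on.simps(1))

text \<open>Bootstrapping: if the derivative inherits every finite order of regularity from
  \<open>f\<close>, each order yields the next. This suits functions whose derivative is expressed
  through themselves, such as \<open>inverse\<close>, \<open>exp\<close> and local inverses.\<close>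

lemma smooth_on_derivI:
  assumes "open S" "\<And>x. x \<in> S \<Longrightarrow> (f has_derivative f' x) (at x)"
    and "\<And>k v. ck_on k S f \<Longrightarrow> ck_on k S (\<lambda>x. f' x v)"
  shows "smooth_on S f"
  unfolding smooth_on_def
proof
  fix k show "ck_on k S f"
  proof (induction k)
    case 0
    then show ?case
      using assms(2) unfolding ck_on.simps
      by (meson differentiableI differentiable_at_imp_differentiable_on differentiable_imp_continuous_on)
  next
    case (Suc k)
    show ?case by (rule ck_on_SucI[OF assms(1,2) assms(3)[OF Suc.IH]])
  qed
qed

context
  fixes S :: "'a::real_normed_vector set"
  assumes S: "open S"
begin

lemma smooth_on_linear: "bounded_linear h \<Longrightarrow> smooth_on S f \<Longrightarrow> smooth_on S (\<lambda>x. h (f x))"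
  unfolding smooth_on_def using ck_on_linear[OF S, of h _ f] by blast

lemma smooth_on_bilinear:
  "bounded_bilinear h \<Longrightarrow> smooth_on S f \<Longrightarrow> smooth_on S g \<Longrightarrow> smooth_on S (\<lambda>x. h (f x) (g x))"
  unfolding smooth_on_def using ck_on_bilinear[OF S, of h _ f g] by blast

lemma smooth_on_const: "smooth_on S (\<lambda>x. c)"
  unfolding smooth_on_def by simp

lemma smooth_on_add: "smooth_on S f \<Longrightarrow> smooth_on S g \<Longrightarrow> smooth_on S (\<lambda>x. f x + g x)"
  unfolding smooth_on_def using ck_on_add[OF S, of _ f g] by blast

lemmas smooth_on_mult = smooth_on_bilinear[OF bounded_bilinear_mult]
lemmas smooth_on_minus = smooth_on_linear[OF bounded_linear_minus[OF bounded_linear_ident]]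
lemmas smooth_on_cnj = smooth_on_linear[OF bounded_linear_cnj]
lemmas smooth_on_Re = smooth_on_linear[OF bounded_linear_Re]
lemmas smooth_on_of_real = smooth_on_linear[OF bounded_linear_of_real]
lemmas smooth_on_nth = smooth_on_linear[OF bounded_linear_vec_nth]

lemma smooth_on_diff:
  assumes "smooth_on S f" "smooth_on S g"
  shows "smooth_on S (\<lambda>x. f x - g x)"
  using smooth_on_add[OF assms(1) smooth_on_minus[OF assms(2)]] by simp

lemma smooth_on_divide_const:
  fixes f :: "'a \<Rightarrow> 'b::real_normed_field"
  shows "smooth_on S f \<Longrightarrow> smooth_on S (\<lambda>x. f x / c)"
  using smooth_on_linear[OF bounded_linear_divide] .

lemmas smooth_on_intros = smooth_on_const smooth_on_add smooth_on_mult smooth_on_minus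
  smooth_on_cnj smooth_on_Re smooth_on_of_real smooth_on_nth smooth_on_diff smooth_on_divide_const

end

lemma smooth_on_inverse:
  "smooth_on (- {0}) (inverse :: 'a::{real_normed_field} \<Rightarrow> 'a)"
proof (rule smooth_on_derivI)
  show "open (- {0::'a})" by auto
  show "(inverse has_derivative (\<lambda>v. - (inverse x * v * inverse x))) (at x)" if "x \<in> - {0}" for x :: 'a
    using that by (intro has_derivative_inverse') auto
  show "ck_on k (- {0}) (\<lambda>x. - (inverse x * v * inverse x))" if "ck_on k (- {0}) (inverse :: 'a \<Rightarrow> 'a)"
    for k and v :: 'a
    using that by (intro ck_on_linear[OF _ bounded_linear_minus[OF bounded_linear_ident]]
      ck_on_bilinear[OF _ bounded_bilinear_mult] ck_on_const) auto
qed

lemma smooth_on_exp_real: "smooth_on UNIV (exp :: real \<Rightarrow> real)"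
proof (rule smooth_on_derivI)
  show "(exp has_derivative (\<lambda>v. exp x * v)) (at x)" for x :: real
    using DERIV_exp[of x] by (simp add: has_field_derivative_def)
  show "ck_on k UNIV (\<lambda>x. exp x * v)" if "ck_on k UNIV (exp :: real \<Rightarrow> real)" for k and v :: real
    using that by (intro ck_on_bilinear[OF _ bounded_bilinear_mult] ck_on_const) auto
qed auto

lemma smooth_on_ln: "smooth_on {0<..} (ln :: real \<Rightarrow> real)"
proof (rule smooth_on_derivI)
  show "(ln has_derivative (\<lambda>v. inverse x * v)) (at x)" if "x \<in> {0<..}" for x :: real
    using DERIV_ln[of x] that by (simp add: has_field_derivative_def)
  show "ck_on k {0<..} (\<lambda>x. inverse x * v)" for k and v :: real
    using ck_on_subset[of k "- {0}" inverse "{0::real<..}"] smooth_on_inverse[where 'a = real]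
    by (intro ck_on_bilinear[OF _ bounded_bilinear_mult] ck_on_const) (auto simp: smooth_on_def)
qed auto

subsection \<open>The inverse function theorem in the plane\<close>

lemma mult_cnj_diff_eq_0_iff: "p * cnj p - q * cnj q = 0 \<longleftrightarrow> (cmod p)\<^sup>2 = (cmod q)\<^sup>2"
  by (metis complex_norm_square eq_iff_diff_eq_0 of_real_eq_iff)

text \<open>The real-linear map \<open>T\<close> of the plane has determinant |p|^2 - |q|^2, and
  \<open>S\<close> is Cramer's rule written in terms of \<open>w\<close> and
  \<open>cnj w\<close>.\<close>

lemma wirtinger_linear_inverse:
  fixes p q v :: complex
  assumes "(cmod p)\<^sup>2 \<noteq> (cmod q)\<^sup>2" and T: "T = (\<lambda>v. p * v + q * cnj v)"
    and S: "S = (\<lambda>w. (cnj p * w - q * cnj w) * inverse (p * cnj p - q * cnj q))"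
  shows "S (T v) = v" "T (S v) = v"
proof -
  define N where "N = p * cnj p - q * cnj q"
  have "N \<noteq> 0"
    using assms(1) unfolding N_def mult_cnj_diff_eq_0_iff .
  have "cnj N = N" by (simp add: N_def)
  have "S (T v) = v * (N * inverse N)"
    unfolding S T N_def[symmetric] by (simp add: N_def algebra_simps)
  then show "S (T v) = v" using \<open>N \<noteq> 0\<close> by simp
  have "T (S v) = v * (N * inverse N)"
    unfolding S T N_def[symmetric] using \<open>cnj N = N\<close> by (simp add: N_def algebra_simps)
  then show "T (S v) = v" using \<open>N \<noteq> 0\<close> by simp
qed

text \<open>The inverse function theorem gives a differentiable inverse \<open>g\<close> with
  derivative \<open>S (g y)\<close>. Since the coefficients of \<open>S\<close> are smooth, this
  formula bootstraps \<open>g\<close> to smoothness.\<close>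

lemma smooth_local_inverse:
  fixes l p q :: "complex \<Rightarrow> complex"
  assumes "open D" "z0 \<in> D"
    and l: "\<And>z. z \<in> D \<Longrightarrow> (l has_derivative (\<lambda>v. p z * v + q z * cnj v)) (at z)"
    and p: "smooth_on D p" and q: "smooth_on D q"
    and nz: "cmod (p z0) \<noteq> cmod (q z0)"
  obtains W H where "open W" "z0 \<in> W" "W \<subseteq> D" "open (l ` W)" "smooth_on (l ` W) H"
    "\<And>w. w \<in> W \<Longrightarrow> H (l w) = w"
proof -
  define S where "S = (\<lambda>z w. (cnj (p z) * w - q z * cnj w) * inverse (p z * cnj (p z) - q z * cnj (q z)))"
  define T where "T = (\<lambda>z v. p z * v + q z * cnj v)"
  \<comment> \<open>Restricting to the points with nonzero determinant makes every derivative
    invertible, so the explicit inverse \<open>S\<close> is available at each \<open>g y\<close> and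
    not only at \<open>z0\<close>.\<close>
  define D' where "D' = D \<inter> (\<lambda>z. (cmod (p z))\<^sup>2 - (cmod (q z))\<^sup>2) -` (- {0})"
  have "continuous_on D (\<lambda>z. (cmod (p z))\<^sup>2 - (cmod (q z))\<^sup>2)"
    using p q by (intro continuous_intros smooth_on_continuous_on)
  then have "open D'"
    unfolding D'_def using assms(1) by (intro continuous_open_preimage) auto
  have "z0 \<in> D'" "D' \<subseteq> D" using nz assms(2) by (auto simp: D'_def)
  have blT: "bounded_linear (T z)" and blS: "bounded_linear (S z)" for z
    unfolding S_def T_def
    by (intro bounded_linear_intros bounded_linear_compose[OF bounded_linear_mult_right]
        bounded_linear_compose[OF bounded_linear_mult_left] bounded_linear_cnj)+
  have ST: "S z (T z v) = v" "T z (S z v) = v" if "z \<in> D'" for z v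
    using that by (intro wirtinger_linear_inverse[of "p z" "q z"]; simp add: D'_def S_def T_def)+
  obtain U' V g g' where U': "open U'" "U' \<subseteq> D'" "z0 \<in> U'" "open V" "homeomorphism U' V l g"
    "\<And>y. y \<in> V \<Longrightarrow> (g has_derivative (g' y)) (at y)"
    "\<And>y. y \<in> V \<Longrightarrow> g' y = inv (blinfun_apply (Blinfun (T (g y))))"
  proof (rule inverse_function_theorem[of D' l "\<lambda>z. Blinfun (T z)" z0 "Blinfun (S z0)"])
    show "(l has_derivative blinfun_apply (Blinfun (T z))) (at z)" if "z \<in> D'" for z
      using l[of z] that \<open>D' \<subseteq> D\<close> unfolding bounded_linear_Blinfun_apply[OF blT]
      by (auto simp: T_def)
    show "continuous_on D' (\<lambda>z. Blinfun (T z))"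
      by (rule continuous_on_blinfun_componentwise)
        (subst bounded_linear_Blinfun_apply[OF blT], unfold T_def, intro continuous_intros
          smooth_on_continuous_on[OF smooth_on_subset[OF p \<open>D' \<subseteq> D\<close>]]
          smooth_on_continuous_on[OF smooth_on_subset[OF q \<open>D' \<subseteq> D\<close>]])
    show "Blinfun (S z0) o\<^sub>L Blinfun (T z0) = id_blinfun"
      by (rule blinfun_eqI) (simp add: bounded_linear_Blinfun_apply blT blS ST \<open>z0 \<in> D'\<close>)
  qed (use \<open>open D'\<close> \<open>z0 \<in> D'\<close> in auto)
  have V: "l ` U' = V" "g ` V = U'" and gl: "\<And>w. w \<in> U' \<Longrightarrow> g (l w) = w"
    using U'(5) by (auto simp: homeomorphism_def)
  have gV: "g ` V \<subseteq> D'" using V U'(2) by auto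
  have "g' y = S (g y)" if "y \<in> V" for y
  proof -
    have "g y \<in> D'" using gV that by auto
    then have "inv (T (g y)) = S (g y)"
      by (intro inv_unique_comp) (auto simp: ST)
    then show ?thesis using U'(7)[OF that] by (simp add: bounded_linear_Blinfun_apply[OF blT])
  qed
  then have g: "(g has_derivative S (g y)) (at y)" if "y \<in> V" for y
    using U'(6) that by metis
  have sm: "smooth_on D' (\<lambda>z. S z w)" for w
  proof -
    have "smooth_on D' (\<lambda>z. inverse (p z * cnj (p z) - q z * cnj (q z)))"
    proof (rule smooth_on_compose[OF \<open>open D'\<close> _ _ smooth_on_inverse])
      show "smooth_on D' (\<lambda>z. p z * cnj (p z) - q z * cnj (q z))"
        using smooth_on_subset[OF p \<open>D' \<subseteq> D\<close>] smooth_on_subset[OF q \<open>D' \<subseteq> D\<close>]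
        by (intro smooth_on_intros \<open>open D'\<close>)
      show "(\<lambda>z. p z * cnj (p z) - q z * cnj (q z)) ` D' \<subseteq> - {0}"
        using mult_cnj_diff_eq_0_iff by (auto simp: D'_def)
    qed auto
    then show ?thesis unfolding S_def
      using smooth_on_subset[OF p \<open>D' \<subseteq> D\<close>] smooth_on_subset[OF q \<open>D' \<subseteq> D\<close>]
      by (intro smooth_on_intros \<open>open D'\<close>)
  qed
  have "smooth_on V g"
    by (rule smooth_on_derivI[OF U'(4) g], assumption, rule ck_on_compose[OF U'(4) \<open>open D'\<close> _ _ gV])
      (use sm in \<open>auto simp: smooth_on_def\<close>)
  then show thesis
    using that[of U' g] U' V gl \<open>D' \<subseteq> D\<close> by auto
qed

subsection \<open>Symmetry of second derivatives\<close>

lemma smooth_on_dx: "smooth_on D f \<Longrightarrow> smooth_on D (dx f)"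
  and smooth_on_dy: "smooth_on D f \<Longrightarrow> smooth_on D (dy f)"
  unfolding dx_def[abs_def] dy_def[abs_def] by (rule smooth_on_frechet_derivative; assumption)+

text \<open>The second difference of \<open>f\<close> over a small square equals the area times
  either mixed partial at suitable points of the square, by the mean value theorem applied twice in
  either order. If the mixed partials differed at \<open>z0\<close>, continuity would keep them
  apart on the square.\<close>

lemma real_mixed_partials_eq:
  fixes f :: "complex \<Rightarrow> real"
  assumes "open D" "smooth_on D f" "z0 \<in> D"
  shows "dx (dy f) z0 = dy (dx f) z0"
proof (rule ccontr)
  assume neq: "dx (dy f) z0 \<noteq> dy (dx f) z0"
  \<comment> \<open>Half the gap: values at distance less than \<open>c\<close> from the two
    partials at \<open>z0\<close> cannot coincide.\<close>
  define c where "c = \<bar>dx (dy f) z0 - dy (dx f) z0\<bar> / 2"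
  have "c > 0" using neq by (simp add: c_def)
  have sx: "smooth_on D (dx f)" and sy: "smooth_on D (dy f)"
    using assms(2) by (auto intro: smooth_on_dx smooth_on_dy)
  have cont: "continuous_on D (dx (dy f))" "continuous_on D (dy (dx f))"
    using sx sy by (auto intro!: smooth_on_continuous_on smooth_on_dx smooth_on_dy)
  obtain r where r: "r > 0" "ball z0 r \<subseteq> D"
      "\<And>z. z \<in> ball z0 r \<Longrightarrow> \<bar>dx (dy f) z - dx (dy f) z0\<bar> < c \<and> \<bar>dy (dx f) z - dy (dx f) z0\<bar> < c"
  proof -
    have "\<exists>r>0. \<forall>z\<in>D. dist z z0 < r \<longrightarrow> dist (g z) (g z0) < c" if "continuous_on D g" for g :: "complex \<Rightarrow> real"
      using that assms(3) \<open>c > 0\<close> unfolding continuous_on_iff by blast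
    from this[OF cont(1)] this[OF cont(2)] obtain r1 r2 where
      "r1 > 0" "\<forall>z\<in>D. dist z z0 < r1 \<longrightarrow> dist (dx (dy f) z) (dx (dy f) z0) < c"
      "r2 > 0" "\<forall>z\<in>D. dist z z0 < r2 \<longrightarrow> dist (dy (dx f) z) (dy (dx f) z0) < c" by blast
    moreover obtain r0 where "r0 > 0" "ball z0 r0 \<subseteq> D" using assms(1,3) openE by blast
    ultimately show thesis
      by (intro that[of "min r0 (min r1 r2)"]) (auto simp: dist_commute dist_real_def subset_iff)
  qed
  \<comment> \<open>Points of the square of side \<open>h\<close> are at distance at most
    \<open>2 * h < r\<close> from \<open>z0\<close>.\<close>
  define h where "h = r / 3"
  have h: "h > 0" using r(1) by (simp add: h_def)
  define P where "P = (\<lambda>s t. z0 + (of_real s + of_real t * \<i>))"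
  have P: "P s t \<in> ball z0 r" if "0 \<le> s" "s \<le> h" "0 \<le> t" "t \<le> h" for s t
  proof -
    have "cmod (of_real s + of_real t * \<i>) \<le> \<bar>s\<bar> + \<bar>t\<bar>"
      by (rule norm_triangle_le) (simp add: norm_mult)
    also have "\<dots> < r" using that r(1) by (simp add: h_def)
    finally show ?thesis unfolding mem_ball by (subst dist_commute) (simp add: P_def dist_norm)
  qed
  have ds: "((\<lambda>s. g (P s t)) has_real_derivative dx g (P s t)) (at s)"
    and dt: "((\<lambda>t. g (P s t)) has_real_derivative dy g (P s t)) (at t)"
    if "smooth_on D g" "0 \<le> s" "s \<le> h" "0 \<le> t" "t \<le> h" for g :: "complex \<Rightarrow> real" and s t
  proof -
    have g: "(g has_derivative frechet_derivative g (at (P s t))) (at (P s t))"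
      using that P r(2) by (meson smooth_on_has_derivative subsetD)
    interpret bounded_linear "frechet_derivative g (at (P s t))" by (rule has_derivative_bounded_linear[OF g])
    have 1: "((\<lambda>s. P s t) has_derivative (\<lambda>v. v *\<^sub>R 1)) (at s)"
      and 2: "((\<lambda>t. P s t) has_derivative (\<lambda>v. v *\<^sub>R \<i>)) (at t)"
      unfolding P_def by (auto intro!: derivative_eq_intros simp: scaleR_conv_of_real)
    show "((\<lambda>s. g (P s t)) has_real_derivative dx g (P s t)) (at s)"
      using has_derivative_compose[OF 1 g] unfolding scaleR
      by (simp add: has_field_derivative_def dx_def mult.commute[of _ "frechet_derivative g (at (P s t)) 1"])
    show "((\<lambda>t. g (P s t)) has_real_derivative dy g (P s t)) (at t)"
      using has_derivative_compose[OF 2 g] unfolding scaleR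
      by (simp add: has_field_derivative_def dy_def mult.commute[of _ "frechet_derivative g (at (P s t)) \<i>"])
  qed
  define \<Delta> where "\<Delta> = f (P h h) - f (P h 0) - f (P 0 h) + f (P 0 0)"
  obtain s where s: "0 < s" "s < h" "\<Delta> = h * (dx f (P s h) - dx f (P s 0))"
    using MVT2[of 0 h "\<lambda>s. f (P s h) - f (P s 0)" "\<lambda>s. dx f (P s h) - dx f (P s 0)"] h
      DERIV_diff[OF ds[OF assms(2)] ds[OF assms(2)]] by (auto simp: \<Delta>_def)
  obtain t where t: "0 < t" "t < h" "dx f (P s h) - dx f (P s 0) = h * dy (dx f) (P s t)"
    using MVT2[of 0 h "\<lambda>t. dx f (P s t)" "\<lambda>t. dy (dx f) (P s t)"] h dt[OF sx] s by auto
  obtain t' where t': "0 < t'" "t' < h" "\<Delta> = h * (dy f (P h t') - dy f (P 0 t'))"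
    using MVT2[of 0 h "\<lambda>t. f (P h t) - f (P 0 t)" "\<lambda>t. dy f (P h t) - dy f (P 0 t)"] h
      DERIV_diff[OF dt[OF assms(2)] dt[OF assms(2)]] by (auto simp: \<Delta>_def)
  obtain s' where s': "0 < s'" "s' < h" "dy f (P h t') - dy f (P 0 t') = h * dx (dy f) (P s' t')"
    using MVT2[of 0 h "\<lambda>s. dy f (P s t')" "\<lambda>s. dx (dy f) (P s t')"] h ds[OF sy] t' by auto
  have "dy (dx f) (P s t) = dx (dy f) (P s' t')"
    using s(3) t(3) t'(3) s'(3) h by auto
  moreover have "P s t \<in> ball z0 r" "P s' t' \<in> ball z0 r" using P s t s' t' by auto
  ultimately have "\<bar>dx (dy f) z0 - dy (dx f) z0\<bar> < 2 * c" using r(3)[of "P s t"] r(3)[of "P s' t'"] by linarith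
  then show False by (simp add: c_def)
qed

lemma dx_linear_comp:
  assumes "bounded_linear h" "g differentiable (at z)"
  shows "dx (\<lambda>z. h (g z)) z = h (dx g z)" "dy (\<lambda>z. h (g z)) z = h (dy g z)"
  using bounded_linear.has_derivative[OF assms(1) assms(2)[unfolded frechet_derivative_works]]
  by (simp_all add: dx_def dy_def frechet_derivative_eq)

lemma dx_cong:
  assumes "open D" "z \<in> D" "\<And>z. z \<in> D \<Longrightarrow> f z = g z" "f differentiable (at z)"
  shows "dx g z = dx f z" "dy g z = dy f z"
  by (simp_all add: dx_def dy_def frechet_derivative_cong_open(1)[OF assms])

lemma smooth_on_differentiable: "smooth_on D f \<Longrightarrow> z \<in> D \<Longrightarrow> f differentiable (at z)"
  using smooth_on_has_derivative differentiable_def by blast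

text \<open>The first-order chain rule holds on all of the open set \<open>D\<close>, hence as an
  identity of functions there, which \<open>dx_cong\<close> allows to be differentiated once
  more.\<close>

lemma second_derivative_linear_comp:
  assumes "open D" "z \<in> D" "bounded_linear h" "smooth_on D g"
  shows "dx (dx (\<lambda>z. h (g z))) z = h (dx (dx g) z)" "dy (dy (\<lambda>z. h (g z))) z = h (dy (dy g) z)"
    "dx (dy (\<lambda>z. h (g z))) z = h (dx (dy g) z)" "dy (dx (\<lambda>z. h (g z))) z = h (dy (dx g) z)"
proof -
  note d = smooth_on_differentiable
  have hs: "smooth_on D (\<lambda>z. h (F z))" if "smooth_on D F" for F
    by (rule smooth_on_linear[OF assms(1,3) that])
  have X: "\<And>z. z \<in> D \<Longrightarrow> h (dx g z) = dx (\<lambda>z. h (g z)) z"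
    and Y: "\<And>z. z \<in> D \<Longrightarrow> h (dy g z) = dy (\<lambda>z. h (g z)) z"
    using dx_linear_comp[OF assms(3) d[OF assms(4)]] by auto
  note sx = smooth_on_dx[OF assms(4)] and sy = smooth_on_dy[OF assms(4)]
  note x = dx_cong[OF assms(1,2) X d[OF hs[OF sx] assms(2)]]
    and y = dx_cong[OF assms(1,2) Y d[OF hs[OF sy] assms(2)]]
  note x' = dx_linear_comp[OF assms(3) d[OF sx assms(2)]] and y' = dx_linear_comp[OF assms(3) d[OF sy assms(2)]]
  show "dx (dx (\<lambda>z. h (g z))) z = h (dx (dx g) z)" "dy (dy (\<lambda>z. h (g z))) z = h (dy (dy g) z)"
    "dx (dy (\<lambda>z. h (g z))) z = h (dx (dy g) z)" "dy (dx (\<lambda>z. h (g z))) z = h (dy (dx g) z)"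
    using x y x' y' by simp_all
qed

lemma mixed_partials_eq:
  fixes f :: "complex \<Rightarrow> complex"
  assumes "open D" "smooth_on D f" "z \<in> D"
  shows "dx (dy f) z = dy (dx f) z"
proof (rule complex_eqI)
  note R = second_derivative_linear_comp[OF assms(1,3) bounded_linear_Re assms(2)]
  note I = second_derivative_linear_comp[OF assms(1,3) bounded_linear_Im assms(2)]
  show "Re (dx (dy f) z) = Re (dy (dx f) z)"
    using real_mixed_partials_eq[OF assms(1) smooth_on_linear[OF assms(1) bounded_linear_Re assms(2)] assms(3)] R
    by simp
  show "Im (dx (dy f) z) = Im (dy (dx f) z)"
    using real_mixed_partials_eq[OF assms(1) smooth_on_linear[OF assms(1) bounded_linear_Im assms(2)] assms(3)] I
    by simp
qed

subsection \<open>Two by two matrices\<close>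

definition mat2 :: "complex \<Rightarrow> complex \<Rightarrow> complex \<Rightarrow> complex \<Rightarrow> cmat" where
  "mat2 a b c d = vector [vector [a, b], vector [c, d]]"

lemma mat2_nth [simp]:
  "mat2 a b c d $ 1 $ 1 = a" "mat2 a b c d $ 1 $ 2 = b"
  "mat2 a b c d $ 2 $ 1 = c" "mat2 a b c d $ 2 $ 2 = d"
  by (simp_all add: mat2_def)

lemma cmat_eq_iff:
  fixes X Y :: cmat
  shows "X = Y \<longleftrightarrow> X$1$1 = Y$1$1 \<and> X$1$2 = Y$1$2 \<and> X$2$1 = Y$2$1 \<and> X$2$2 = Y$2$2"
  by (auto simp: vec_eq_iff forall_2)

lemma mat2_eta: "mat2 (X$1$1) (X$1$2) (X$2$1) (X$2$2) = X"
  by (simp add: cmat_eq_iff)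

lemma mat2_eq_iff [simp]: "mat2 a b c d = mat2 a' b' c' d' \<longleftrightarrow> a = a' \<and> b = b' \<and> c = c' \<and> d = d'"
  by (simp add: cmat_eq_iff)

lemma mat2_mult: "mat2 a b c d ** mat2 a' b' c' d' =
    mat2 (a*a' + b*c') (a*b' + b*d') (c*a' + d*c') (c*b' + d*d')"
  by (simp add: cmat_eq_iff matrix_matrix_mult_def sum_2)

lemma mat2_simps:
  "c *\<^sub>C mat2 x y z t = mat2 (c*x) (c*y) (c*z) (c*t)"
  "mat2 x y z t + mat2 x' y' z' t' = mat2 (x+x') (y+y') (z+z') (t+t')"
  "mat2 x y z t - mat2 x' y' z' t' = mat2 (x-x') (y-y') (z-z') (t-t')"
  "ctransp (mat2 x y z t) = mat2 (cnj x) (cnj z) (cnj y) (cnj t)"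
  "det (mat2 x y z t) = x*t - y*z" "trace (mat2 x y z t) = x + t"
  by (simp_all add: cmat_eq_iff cscale_def ctransp_def det_2 trace_def sum_2)

lemma basis_mat2: "mat 1 = mat2 1 0 0 1" "e0 = mat2 1 0 0 1" "e1 = mat2 1 0 0 (-1)" "eh2 = mat2 0 \<i> 0 0" "eh3 = mat2 0 0 (-\<i>) 0"
  by (simp_all add: e0_def mat_def cmat_eq_iff e1_def eh2_def eh3_def)

lemma matrix_inv_mat2:
  assumes "a * d - b * c = 1"
  shows "matrix_inv (mat2 a b c d) = mat2 d (-b) (-c) a"
proof -
  let ?A = "mat2 a b c d" and ?B = "mat2 d (-b) (-c) a"
  have 1: "?B ** ?A = mat 1"
    using assms by (simp add: mat2_mult basis_mat2 algebra_simps)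
  have "?A ** matrix_inv ?A = mat 1"
    by (rule matrix_inv_cancel) (simp add: mat2_simps assms)
  then show ?thesis by (metis 1 matrix_mul_assoc matrix_mul_lid matrix_mul_rid)
qed

lemma bounded_linear_entry: "bounded_linear (\<lambda>X::cmat. X $ i $ j)"
  by (rule bounded_linear_compose[OF bounded_linear_vec_nth bounded_linear_vec_nth])

lemma bounded_bilinear_cmat_mult: "bounded_bilinear ((**) :: cmat \<Rightarrow> cmat \<Rightarrow> cmat)"
  unfolding bilinear_conv_bounded_bilinear[symmetric] bilinear_def
  by (intro conjI allI linearI; simp add: cmat_eq_iff matrix_matrix_mult_def sum_2 scaleR_add_right
      distrib_left distrib_right)

lemma smooth_on_cmatI:
  fixes L :: "'a::real_normed_vector \<Rightarrow> cmat"
  assumes "open S" "\<And>i j. smooth_on S (\<lambda>z. L z $ i $ j)"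
  shows "smooth_on S L"
proof -
  have lin: "bounded_linear (\<lambda>c::complex. axis i (axis j c) :: cmat)" for i j
    unfolding linear_conv_bounded_linear[symmetric]
    by (auto intro!: linearI simp: axis_def vec_eq_iff)
  have "smooth_on S (\<lambda>z. axis 1 (axis 1 (L z$1$1)) + axis 1 (axis 2 (L z$1$2)) +
      (axis 2 (axis 1 (L z$2$1)) + axis 2 (axis 2 (L z$2$2))) :: cmat)"
    by (intro smooth_on_add[OF assms(1)] smooth_on_linear[OF assms(1) lin] assms(2))
  then show ?thesis
    by (rule smooth_on_cong[OF assms(1), rotated]) (simp add: cmat_eq_iff axis_def)
qed

text \<open>Differentiating the constant \<open>trace (X ** X)\<close> along a curve in
  \<open>N\<close> shows that the position vector is orthogonal to tangent vectors. A Laplacian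
  proportional to the map itself is therefore normal.\<close>

lemma trace_mult_tangent_space:
  assumes "v \<in> tangent_space N p" "\<And>X. X \<in> N \<Longrightarrow> trace (X ** X) = c"
  shows "trace (p ** v) = 0"
proof -
  obtain \<gamma> where \<gamma>: "\<gamma> (0::real) = p" "\<And>t. \<gamma> t \<in> N" "(\<gamma> has_vector_derivative v) (at 0)"
    using assms(1) by (auto simp: tangent_space_def)
  have tr: "bounded_linear (trace :: cmat \<Rightarrow> complex)"
    unfolding linear_conv_bounded_linear[symmetric]
    by (auto intro!: linearI simp: trace_def sum_2 algebra_simps)
  have "((\<lambda>t. trace (\<gamma> t ** \<gamma> t)) has_vector_derivative trace (\<gamma> 0 ** v + v ** \<gamma> 0)) (at 0)"
    by (rule bounded_linear.has_vector_derivative[OF tr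
        bounded_bilinear.has_vector_derivative[OF bounded_bilinear_cmat_mult \<gamma>(3) \<gamma>(3)]])
  moreover have "((\<lambda>t. trace (\<gamma> t ** \<gamma> t)) has_vector_derivative 0) (at 0)"
    using assms(2)[OF \<gamma>(2)] by simp
  ultimately have "trace (\<gamma> 0 ** v + v ** \<gamma> 0) = 0"
    by (rule vector_derivative_unique_at)
  then show ?thesis
    unfolding \<gamma>(1) by (simp add: trace_add trace_mul_sym[of v p])
qed

subsection \<open>The quadrics\<close>

text \<open>For real \<open>s\<close> this is the general element of su(1,1) if \<open>e = 1\<close>
  and of su(2) if \<open>e = -1\<close>, with determinant
  \<open>s * s - e * w * cnj w\<close>.\<close>

definition quadric_point :: "complex \<Rightarrow> complex \<Rightarrow> complex \<Rightarrow> cmat" where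
  "quadric_point e s w = mat2 (\<i> * s) w (e * cnj w) (- \<i> * s)"

text \<open>The sign \<open>e\<close> lets SU(1,1) and SU(2) be treated by one computation.\<close>

definition special_group :: "complex \<Rightarrow> cmat set" where
  "special_group e = {mat2 a b (e * cnj b) (cnj a) | a b. a * cnj a - e * b * cnj b = 1}"

definition geodesic_orbit :: "complex \<Rightarrow> cmat set" where
  "geodesic_orbit e = (\<lambda>g. \<i> *\<^sub>C (g ** e1 ** matrix_inv g)) ` special_group e"

text \<open>For determinant one the adjugate formula for the inverse turns the group condition into
  equations between entries; for any other determinant both memberships fail.\<close>

lemma SU11_eq: "SU11 = special_group 1"
proof -
  have "g \<in> SU11 \<longleftrightarrow> g \<in> special_group 1" for g
  proof -
    obtain a b c d where g: "g = mat2 a b c d" by (metis mat2_eta)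
    show ?thesis
    proof (cases "a * d - b * c = 1")
      case True
      then have "cnj a * cnj d - cnj c * cnj b = 1"
        by (metis complex_cnj_diff complex_cnj_mult complex_cnj_one mult.commute)
      then show ?thesis using True
        by (auto simp: g SU11_def SL2C_def special_group_def mat2_simps matrix_inv_mat2 mat2_mult basis_mat2)
    next
      case False
      then show ?thesis
        by (auto simp: g SU11_def SL2C_def special_group_def mat2_simps algebra_simps)
    qed
  qed
  then show ?thesis by blast
qed

lemma SU2_eq: "SU2 = special_group (-1)"
proof -
  have "g \<in> SU2 \<longleftrightarrow> g \<in> special_group (-1)" for g
  proof -
    obtain a b c d where g: "g = mat2 a b c d" by (metis mat2_eta)
    show ?thesis
    proof (cases "a * d - b * c = 1")
      case True
      then have "cnj a * cnj d - cnj c * cnj b = 1"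
        by (metis complex_cnj_diff complex_cnj_mult complex_cnj_one mult.commute)
      then show ?thesis using True
        by (auto simp: g SU2_def SL2C_def special_group_def mat2_simps matrix_inv_mat2 mat2_mult basis_mat2)
    next
      case False
      then show ?thesis
        by (auto simp: g SU2_def SL2C_def special_group_def mat2_simps algebra_simps)
    qed
  qed
  then show ?thesis by blast
qed

lemma H2_eq: "H2 = geodesic_orbit 1" and S2_eq: "S2 = geodesic_orbit (-1)"
  by (simp_all add: H2_def S2_def geodesic_orbit_def SU11_eq SU2_eq)

text \<open>This is the Hopf map in the coordinates \<open>s\<close> and \<open>w\<close>: the
  classical one for \<open>e = -1\<close>, its hyperbolic analogue for \<open>e = 1\<close>.\<close>

lemma special_group_orbit_point:
  assumes "g = mat2 a b (e * cnj b) (cnj a)" "a * cnj a - e * b * cnj b = 1"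
    and "e = 1 \<or> e = -1"
  shows "\<i> *\<^sub>C (g ** e1 ** matrix_inv g) = quadric_point e (a * cnj a + e * b * cnj b) (- 2 * \<i> * a * b)"
proof -
  have "a * cnj a - b * (e * cnj b) = 1" using assms(2) by (simp add: algebra_simps)
  from matrix_inv_mat2[OF this] show ?thesis using assms(3)
    by (auto simp: assms(1) quadric_point_def mat2_mult basis_mat2 mat2_simps algebra_simps)
qed

lemma geodesic_orbit_quadric:
  assumes "X \<in> geodesic_orbit e" and e: "e = 1 \<or> e = -1"
  obtains s w where "X = quadric_point e s w" "cnj s = s" "s * s - e * w * cnj w = 1"
proof -
  obtain g a b where X: "X = \<i> *\<^sub>C (g ** e1 ** matrix_inv g)"
      "g = mat2 a b (e * cnj b) (cnj a)" and ab: "a * cnj a - e * b * cnj b = 1"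
    using assms(1) by (auto simp: geodesic_orbit_def special_group_def)
  let ?s = "a * cnj a + e * b * cnj b" and ?w = "- 2 * \<i> * a * b"
  have "?s * ?s - e * ?w * cnj ?w = (a * cnj a - e * b * cnj b)\<^sup>2"
    using e by (auto simp: power2_eq_square algebra_simps)
  then have "?s * ?s - e * ?w * cnj ?w = 1" by (simp only: ab power_one)
  moreover have "cnj ?s = ?s" using e by (auto simp: algebra_simps)
  ultimately show thesis
    using that special_group_orbit_point[OF X(2) ab e] X(1) by blast
qed

text \<open>The trace is -2 times the left side of the quadric equation. Its constancy is what
  \<open>trace_mult_tangent_space\<close> requires.\<close>

lemma trace_geodesic_orbit_square:
  assumes "X \<in> geodesic_orbit e" "e = 1 \<or> e = -1"
  shows "trace (X ** X) = - 2"
proof -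
  obtain s w where X: "X = quadric_point e s w" and 1: "s * s - e * w * cnj w = 1"
    using geodesic_orbit_quadric[OF assms] by metis
  have "trace (X ** X) = - 2 * (s * s - e * w * cnj w)"
    by (simp add: X quadric_point_def mat2_mult mat2_simps algebra_simps)
  then show ?thesis using 1 by simp
qed

text \<open>The inverse of \<open>g = mat2 a b (e * cnj b) (cnj a)\<close> conjugates \<open>quadric_point e s w\<close> to
  \<open>quadric_point e s' w'\<close>. The orbit point \<open>i g e1 g\<^sup>-\<^sup>1\<close> goes to \<open>s' = 1\<close>, \<open>w' = 0\<close>, and \<open>w'\<close> is a chart
  of the region \<open>s' > 0\<close> around it.\<close>

lemma quadric_rotation:
  fixes a b e s w :: complex
  assumes e: "e = 1 \<or> e = -1" and ab: "a * cnj a - e * b * cnj b = 1" and s: "cnj s = s"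
    and s': "s' = (a * cnj a + e * b * cnj b) * s + \<i> * e * (a * b * cnj w - cnj a * cnj b * w)"
    and w': "w' = (cnj a)\<^sup>2 * w - e * b\<^sup>2 * cnj w + 2 * \<i> * cnj a * b * s"
  shows "cnj s' = s'" "s' * s' - e * w' * cnj w' = s * s - e * w * cnj w"
    "w = a\<^sup>2 * w' - e * b\<^sup>2 * cnj w' - 2 * \<i> * a * b * s'"
    "s = (a * cnj a + e * b * cnj b) * s' - \<i> * e * (cnj a * b * cnj w' - a * cnj b * w')"
proof -
  \<comment> \<open>Treating the conjugates as independent variables makes the claims polynomial
    identities, each carrying the factor \<open>(a * A - e * b * B)\<^sup>2 = 1\<close>.\<close>
  define A B W where "A = cnj a" and "B = cnj b" and "W = cnj w"
  have ab': "a * A - e * b * B = 1" using ab by (simp add: A_def B_def)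
  have S': "s' = (a * A + e * b * B) * s + \<i> * e * (a * b * W - A * B * w)"
    and W': "w' = A\<^sup>2 * w - e * b\<^sup>2 * W + 2 * \<i> * A * b * s"
    and CW: "cnj w' = a\<^sup>2 * W - e * B\<^sup>2 * w - 2 * \<i> * a * B * s"
    using e s by (auto simp: s' w' A_def B_def W_def)
  show "cnj s' = s'" using e s by (auto simp: s' algebra_simps)
  have "s' * s' - e * w' * cnj w' = (a * A - e * b * B)\<^sup>2 * (s * s - e * w * W)"
    unfolding S' CW unfolding W' using e by (auto simp: power2_eq_square algebra_simps)
  then show "s' * s' - e * w' * cnj w' = s * s - e * w * cnj w"
    by (simp add: ab' W_def)
  have "a\<^sup>2 * w' - e * b\<^sup>2 * cnj w' - 2 * \<i> * a * b * s' = (a * A - e * b * B)\<^sup>2 * w"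
    unfolding S' CW unfolding W' using e by (auto simp: power2_eq_square algebra_simps)
  then show "w = a\<^sup>2 * w' - e * b\<^sup>2 * cnj w' - 2 * \<i> * a * b * s'"
    by (simp add: ab')
  have "(a * A + e * b * B) * s' - \<i> * e * (A * b * cnj w' - a * B * w') = (a * A - e * b * B)\<^sup>2 * s"
    unfolding S' CW unfolding W' using e by (auto simp: power2_eq_square algebra_simps)
  then show "s = (a * cnj a + e * b * cnj b) * s' - \<i> * e * (cnj a * b * cnj w' - a * cnj b * w')"
    unfolding A_def[symmetric] B_def[symmetric] by (simp add: ab')
qed

text \<open>The chart value determines the square of the rotated first coordinate through the
  quadric equation, and positivity fixes its sign. The inverse formulas of
  \<open>quadric_rotation\<close> then recover \<open>s\<close> and \<open>w\<close>.\<close>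

lemma quadric_chart_inj:
  fixes a b e s w :: complex
  assumes "e = 1 \<or> e = -1" "a * cnj a - e * b * cnj b = 1"
    and "cnj s\<^sub>1 = s\<^sub>1" "s\<^sub>1 * s\<^sub>1 - e * w\<^sub>1 * cnj w\<^sub>1 = 1" "cnj s\<^sub>2 = s\<^sub>2" "s\<^sub>2 * s\<^sub>2 - e * w\<^sub>2 * cnj w\<^sub>2 = 1"
    and T: "T = (\<lambda>s w. (a * cnj a + e * b * cnj b) * s + \<i> * e * (a * b * cnj w - cnj a * cnj b * w))"
    and C: "C = (\<lambda>s w. (cnj a)\<^sup>2 * w - e * b\<^sup>2 * cnj w + 2 * \<i> * cnj a * b * s)"
    and pos: "Re (T s\<^sub>1 w\<^sub>1) > 0" "Re (T s\<^sub>2 w\<^sub>2) > 0" and eq: "C s\<^sub>1 w\<^sub>1 = C s\<^sub>2 w\<^sub>2"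
  shows "s\<^sub>1 = s\<^sub>2" "w\<^sub>1 = w\<^sub>2"
proof -
  note 1 = quadric_rotation[OF assms(1-3) fun_cong[OF fun_cong[OF T], of s\<^sub>1 w\<^sub>1] fun_cong[OF fun_cong[OF C], of s\<^sub>1 w\<^sub>1]]
  note 2 = quadric_rotation[OF assms(1,2,5) fun_cong[OF fun_cong[OF T], of s\<^sub>2 w\<^sub>2] fun_cong[OF fun_cong[OF C], of s\<^sub>2 w\<^sub>2]]
  have "T s\<^sub>1 w\<^sub>1 * T s\<^sub>1 w\<^sub>1 = T s\<^sub>2 w\<^sub>2 * T s\<^sub>2 w\<^sub>2"
    using 1(2) 2(2) assms(4,6) unfolding eq by (metis diff_eq_eq)
  then have "T s\<^sub>1 w\<^sub>1 = T s\<^sub>2 w\<^sub>2 \<or> T s\<^sub>1 w\<^sub>1 = - T s\<^sub>2 w\<^sub>2" by (simp add: square_eq_iff)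
  then have T_eq: "T s\<^sub>1 w\<^sub>1 = T s\<^sub>2 w\<^sub>2" using pos by auto
  show "w\<^sub>1 = w\<^sub>2" using 1(3) 2(3) unfolding T_eq eq by simp
  show "s\<^sub>1 = s\<^sub>2" using 1(4) 2(4) unfolding T_eq eq by simp
qed

subsection \<open>Frames in the special groups\<close>

lemma frechet_derivative_directional:
  assumes "f differentiable (at z)" "g differentiable (at z)"
  shows "dx (\<lambda>z. f z + g z) z = dx f z + dx g z" "dy (\<lambda>z. f z + g z) z = dy f z + dy g z"
    "dx (\<lambda>z. f z - g z) z = dx f z - dx g z" "dy (\<lambda>z. f z - g z) z = dy f z - dy g z"
  using has_derivative_add[OF assms[unfolded frechet_derivative_works]]
    has_derivative_diff[OF assms[unfolded frechet_derivative_works]]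
  by (simp_all add: dx_def dy_def frechet_derivative_eq)

lemma frechet_derivative_directional_minus:
  assumes "f differentiable (at z)"
  shows "dx (\<lambda>z. - f z) z = - dx f z" "dy (\<lambda>z. - f z) z = - dy f z"
  using has_derivative_minus[OF assms[unfolded frechet_derivative_works]]
  by (simp_all add: dx_def dy_def frechet_derivative_eq)

lemma frechet_derivative_directional_mult:
  fixes f g :: "complex \<Rightarrow> complex"
  assumes "f differentiable (at z)" "g differentiable (at z)"
  shows "dx (\<lambda>z. f z * g z) z = dx f z * g z + f z * dx g z"
    "dy (\<lambda>z. f z * g z) z = dy f z * g z + f z * dy g z"
  using has_derivative_mult[OF assms[unfolded frechet_derivative_works]]
  by (simp_all add: dx_def dy_def frechet_derivative_eq)

lemma frechet_derivative_directional_const: "dx (\<lambda>z. c) z = 0" "dy (\<lambda>z. c) z = 0"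
  by (simp_all add: dx_def dy_def frechet_derivative_const)

lemma differentiable_cnj: "f differentiable (at z) \<Longrightarrow> (\<lambda>z. cnj (f z)) differentiable (at z)"
  unfolding differentiable_def using bounded_linear.has_derivative[OF bounded_linear_cnj] by blast

lemmas directional_simps = differentiable_minus True_implies_equals implies_True_equals triv_forall_equality
  frechet_derivative_directional_minus frechet_derivative_directional frechet_derivative_directional_mult
  frechet_derivative_directional_const dx_linear_comp[OF bounded_linear_cnj]
  differentiable_cnj differentiable_add differentiable_diff differentiable_mult differentiable_const

lemma directional_derivatives_eq:
  assumes "(f has_derivative f') (at z)"
  shows "dx f z = f' 1" "dy f z = f' \<i>"
  using frechet_derivative_eq[OF assms] by (simp_all add: dx_def dy_def)

lemma laplacian_linear_comp:
  assumes "open D" "z \<in> D" "bounded_linear h" "smooth_on D g"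
  shows "laplacian (\<lambda>z. h (g z)) z = h (laplacian g z)"
  using second_derivative_linear_comp[OF assms] linear_add[OF bounded_linear.linear[OF assms(3)]]
  by (simp add: laplacian_def)

text \<open>The frame \<open>mat2 a b (e * cnj b) (cnj a)\<close> pulls back the Maurer-Cartan form to
  \<open>U dz + V dzbar\<close> with \<open>U = mat2 \<omega> \<beta> \<gamma> (- \<omega>)\<close>; the \<open>dzbar\<close>-part is then determined by reality.\<close>

locale special_frame =
  fixes D :: "complex set" and e :: complex and \<omega> \<beta> \<gamma> a b :: "complex \<Rightarrow> complex"
  assumes open_D: "open D" and e: "e = 1 \<or> e = -1"
    and smooth_omega: "smooth_on D \<omega>" and smooth_beta: "smooth_on D \<beta>" and smooth_gamma: "smooth_on D \<gamma>"
    and deriv_a: "\<And>z. z \<in> D \<Longrightarrow> (a has_derivative (\<lambda>v. a z * (v * \<omega> z - cnj v * cnj (\<omega> z)) +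
        e * b z * (cnj v * cnj (\<beta> z) + e * v * \<gamma> z))) (at z)"
    and deriv_b: "\<And>z. z \<in> D \<Longrightarrow> (b has_derivative (\<lambda>v. a z * (v * \<beta> z + e * cnj v * cnj (\<gamma> z)) -
        b z * (v * \<omega> z - cnj v * cnj (\<omega> z)))) (at z)"
    and unit: "\<And>z. z \<in> D \<Longrightarrow> a z * cnj (a z) - e * b z * cnj (b z) = 1"
    and beta: "\<And>z. z \<in> D \<Longrightarrow> dx \<beta> z + \<i> * dy \<beta> z = 4 * cnj (\<omega> z) * \<beta> z"
    and nondegenerate: "\<And>z. z \<in> D \<Longrightarrow> cmod (\<gamma> z) < cmod (\<beta> z)"
begin

text \<open>The derivatives of \<open>a\<close> and \<open>b\<close> involve both functions, so
  their regularity is raised simultaneously.\<close>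

lemma smooth_a: "smooth_on D a" and smooth_b: "smooth_on D b"
proof -
  note intros = ck_on_bilinear[OF open_D bounded_bilinear_mult] ck_on_linear[OF open_D bounded_linear_cnj]
    ck_on_add[OF open_D] ck_on_const
  have diff: "ck_on k D (\<lambda>z. f z - g z)" if "ck_on k D f" "ck_on k D g" for k and f g :: "complex \<Rightarrow> complex"
    using ck_on_add[OF open_D that(1) ck_on_linear[OF open_D bounded_linear_minus[OF bounded_linear_ident] that(2)]]
    by simp
  have coeff: "ck_on k D \<omega>" "ck_on k D \<beta>" "ck_on k D \<gamma>" for k
    using smooth_omega smooth_beta smooth_gamma by (auto simp: smooth_on_def)
  have "ck_on k D a \<and> ck_on k D b" for k
  proof (induction k)
    case 0
    then show ?case using deriv_a deriv_b unfolding ck_on.simps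
      by (meson differentiableI differentiable_at_imp_differentiable_on differentiable_imp_continuous_on)
  next
    case (Suc k)
    then have ab: "ck_on k D a" "ck_on k D b" by auto
    show ?case
      by (intro conjI ck_on_SucI[OF open_D deriv_a] ck_on_SucI[OF open_D deriv_b])
        (assumption | intro intros diff ab coeff)+
  qed
  then show "smooth_on D a" "smooth_on D b" by (auto simp: smooth_on_def)
qed

lemma diff [simp]:
  assumes "z \<in> D"
  shows "a differentiable (at z)" "b differentiable (at z)" "\<omega> differentiable (at z)"
    "\<beta> differentiable (at z)" "\<gamma> differentiable (at z)"
  using smooth_a smooth_b smooth_omega smooth_beta smooth_gamma assms by (auto intro: smooth_on_differentiable)

lemma dx_a: "z \<in> D \<Longrightarrow> dx a z = a z * (\<omega> z - cnj (\<omega> z)) + e * b z * (cnj (\<beta> z) + e * \<gamma> z)"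
  and dy_a: "z \<in> D \<Longrightarrow> dy a z = \<i> * a z * (\<omega> z + cnj (\<omega> z)) + \<i> * e * b z * (e * \<gamma> z - cnj (\<beta> z))"
  and dx_b: "z \<in> D \<Longrightarrow> dx b z = a z * (\<beta> z + e * cnj (\<gamma> z)) - b z * (\<omega> z - cnj (\<omega> z))"
  and dy_b: "z \<in> D \<Longrightarrow> dy b z = \<i> * a z * (\<beta> z - e * cnj (\<gamma> z)) - \<i> * b z * (\<omega> z + cnj (\<omega> z))"
  using directional_derivatives_eq[OF deriv_a[of z]] directional_derivatives_eq[OF deriv_b[of z]]
  by (auto simp: algebra_simps)

lemma dir_cong:
  assumes "z \<in> D" "\<And>z. z \<in> D \<Longrightarrow> f z = g z" "g differentiable (at z)"
  shows "dx f z = dx g z" "dy f z = dy g z"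
  using dx_cong[OF open_D assms(1) assms(2)[symmetric] assms(3)] by auto

text \<open>The \<open>\<gamma>\<close>-entry of the Maurer-Cartan equation; with the entry \<open>beta\<close> it says that the
  Klotz differential is holomorphic.\<close>

lemma gamma:
  assumes z: "z \<in> D"
  shows "dx \<gamma> z + \<i> * dy \<gamma> z = - 4 * cnj (\<omega> z) * \<gamma> z"
proof -
  \<comment> \<open>The matrix with rows \<open>(R, S)\<close> and \<open>(e * cnj S, - R)\<close>
    is, up to sign, the curvature of the pulled back Maurer-Cartan form in the directions
    \<open>1\<close> and \<open>\<i>\<close>. Commuting second derivatives of the frame say that the
    row \<open>(a, b)\<close> annihilates it.\<close>
  define R where "R = dy \<omega> z - cnj (dy \<omega> z) - \<i> * (dx \<omega> z + cnj (dx \<omega> z))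
    + e * (\<i> * (\<beta> z - e * cnj (\<gamma> z)) * (cnj (\<beta> z) + e * \<gamma> z)
         + \<i> * (\<beta> z + e * cnj (\<gamma> z)) * (cnj (\<beta> z) - e * \<gamma> z))"
  define S where "S = dy \<beta> z + e * cnj (dy \<gamma> z) - \<i> * (dx \<beta> z - e * cnj (dx \<gamma> z))
    + 4 * \<i> * (cnj (\<omega> z) * \<beta> z + e * \<omega> z * cnj (\<gamma> z))"
  have R': "cnj R = - R" using e unfolding R_def by (auto simp: algebra_simps)
  have a2: "dy (dx a) z - dx (dy a) z = a z * R + e * b z * cnj S"
    using e z unfolding dir_cong(2)[where f = "dx a", OF z dx_a, simplified directional_simps diff[OF z]]
      dir_cong(1)[where f = "dy a", OF z dy_a, simplified directional_simps diff[OF z]]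
    by (auto simp: directional_simps dx_a dy_a dx_b dy_b R_def S_def algebra_simps)
  have b2: "dy (dx b) z - dx (dy b) z = a z * S - b z * R"
    using e z unfolding dir_cong(2)[where f = "dx b", OF z dx_b, simplified directional_simps diff[OF z]]
      dir_cong(1)[where f = "dy b", OF z dy_b, simplified directional_simps diff[OF z]]
    by (auto simp: directional_simps dx_a dy_a dx_b dy_b R_def S_def algebra_simps)
  have 1: "a z * R + e * b z * cnj S = 0" and 2: "a z * S - b z * R = 0"
    using a2 b2 mixed_partials_eq[OF open_D smooth_a z] mixed_partials_eq[OF open_D smooth_b z] by auto
  \<comment> \<open>Conjugation supplies a second linear equation for \<open>S\<close> and
    \<open>R\<close>; by \<open>unit\<close> the resulting system has determinant of modulus one,
    and eliminating \<open>R\<close> gives \<open>S = 0\<close>.\<close>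
  have "cnj (a z * R + e * b z * cnj S) = 0" unfolding 1 by simp
  then have 3: "e * cnj (b z) * S - cnj (a z) * R = 0" using e by (auto simp: R')
  have "S = (a z * cnj (a z) - e * b z * cnj (b z)) * S" using unit[OF z] by simp
  also have "\<dots> = cnj (a z) * (a z * S - b z * R) - b z * (e * cnj (b z) * S - cnj (a z) * R)"
    by (simp add: algebra_simps)
  also have "\<dots> = 0" unfolding 2 3 by simp
  finally have "S = 0" .
  have "dx \<gamma> z + \<i> * dy \<gamma> z + 4 * cnj (\<omega> z) * \<gamma> z =
      e * cnj (dx \<beta> z + \<i> * dy \<beta> z - 4 * cnj (\<omega> z) * \<beta> z) + \<i> * e * cnj S"
    using e by (auto simp: S_def algebra_simps)
  also have "\<dots> = 0" unfolding beta[OF z] \<open>S = 0\<close> by simp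
  finally show ?thesis by (simp add: eq_neg_iff_add_eq_0)
qed

section \<open>The Gauss map of a special frame and its Laplacian\<close>

definition "s z = a z * cnj (a z) + e * b z * cnj (b z)"
definition "w z = - 2 * \<i> * a z * b z"

lemma smooth_s: "smooth_on D s" and smooth_w: "smooth_on D w"
  unfolding s_def[abs_def] w_def[abs_def] by (intro smooth_on_intros open_D smooth_a smooth_b)+

lemma cnj_s: "cnj (s z) = s z"
  using e by (auto simp: s_def mult.commute)

lemma quadric: "z \<in> D \<Longrightarrow> s z * s z - e * w z * cnj (w z) = 1"
proof -
  assume z: "z \<in> D"
  have "s z * s z - e * w z * cnj (w z) = (a z * cnj (a z) - e * b z * cnj (b z))\<^sup>2"
    using e by (auto simp: s_def w_def power2_eq_square algebra_simps)
  then show ?thesis by (simp add: unit[OF z])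
qed

definition "L z = quadric_point e (s z) (w z)"

lemma L_nth: "L z $ 1 $ 1 = \<i> * s z" "L z $ 1 $ 2 = w z" "L z $ 2 $ 1 = e * cnj (w z)" "L z $ 2 $ 2 = - \<i> * s z"
  by (simp_all add: L_def quadric_point_def)

lemma smooth_L: "smooth_on D L"
proof (rule smooth_on_cmatI[OF open_D])
  fix i j :: 2
  have "smooth_on D (\<lambda>z. \<i> * s z)" "smooth_on D w" "smooth_on D (\<lambda>z. e * cnj (w z))" "smooth_on D (\<lambda>z. - \<i> * s z)"
    by (intro smooth_on_intros open_D smooth_s smooth_w)+
  then show "smooth_on D (\<lambda>z. L z $ i $ j)"
    using exhaust_2[of i] exhaust_2[of j] by (auto simp: L_nth)
qed

lemma dx_s: "z \<in> D \<Longrightarrow> dx s z = 2 * e * (a z * cnj (b z) * (\<beta> z + e * cnj (\<gamma> z)) + cnj (a z) * b z * (cnj (\<beta> z) + e * \<gamma> z))"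
  and dy_s: "z \<in> D \<Longrightarrow> dy s z = 2 * \<i> * e * (a z * cnj (b z) * (\<beta> z - e * cnj (\<gamma> z)) - cnj (a z) * b z * (cnj (\<beta> z) - e * \<gamma> z))"
  and dx_w: "z \<in> D \<Longrightarrow> dx w z = - 2 * \<i> * (a z * a z * (\<beta> z + e * cnj (\<gamma> z)) + e * b z * b z * (cnj (\<beta> z) + e * \<gamma> z))"
  and dy_w: "z \<in> D \<Longrightarrow> dy w z = 2 * (a z * a z * (\<beta> z - e * cnj (\<gamma> z)) - e * b z * b z * (cnj (\<beta> z) - e * \<gamma> z))"
  unfolding s_def[abs_def] w_def[abs_def] using e
  by (auto simp: directional_simps dx_a dy_a dx_b dy_b algebra_simps)

text \<open>Up to the sign \<open>e\<close>, this is the squared length of the differential of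
  \<open>L\<close> in the metric of the target, as expected for a harmonic map into a
  quadric.\<close>

definition "\<mu> z = 8 * e * (\<beta> z * cnj (\<beta> z) + \<gamma> z * cnj (\<gamma> z))"

lemma beta': "z \<in> D \<Longrightarrow> dx \<beta> z = 4 * cnj (\<omega> z) * \<beta> z - \<i> * dy \<beta> z"
  using beta by (simp add: eq_diff_eq)

lemma gamma': "z \<in> D \<Longrightarrow> dx \<gamma> z = - 4 * cnj (\<omega> z) * \<gamma> z - \<i> * dy \<gamma> z"
  using gamma by (simp add: eq_diff_eq)

text \<open>In the sum of the second derivatives, \<open>\<beta>\<close> and \<open>\<gamma>\<close>
  are differentiated only in the combination \<open>dx + \<i> * dy\<close> or its conjugate. The
  equations \<open>beta\<close> and \<open>gamma\<close> evaluate these, and the terms with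
  \<open>\<omega>\<close> cancel.\<close>

lemma laplacian_s: "z \<in> D \<Longrightarrow> laplacian s z = \<mu> z * s z"
  and laplacian_w: "z \<in> D \<Longrightarrow> laplacian w z = \<mu> z * w z"
proof -
  assume z: "z \<in> D"
  show "laplacian s z = \<mu> z * s z"
    using e z unfolding laplacian_def dir_cong(1)[where f = "dx s", OF z dx_s, simplified directional_simps diff[OF z]]
      dir_cong(2)[where f = "dy s", OF z dy_s, simplified directional_simps diff[OF z]]
    by (auto simp: directional_simps dx_a dy_a dx_b dy_b beta' gamma' \<mu>_def s_def algebra_simps)
  show "laplacian w z = \<mu> z * w z"
    using e z unfolding laplacian_def dir_cong(1)[where f = "dx w", OF z dx_w, simplified directional_simps diff[OF z]]
      dir_cong(2)[where f = "dy w", OF z dy_w, simplified directional_simps diff[OF z]]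
    by (auto simp: directional_simps dx_a dy_a dx_b dy_b beta' gamma' \<mu>_def w_def algebra_simps)
qed

lemma laplacian_L:
  assumes z: "z \<in> D"
  shows "laplacian L z = \<mu> z *\<^sub>C L z"
proof -
  have entry: "laplacian L z $ i $ j = laplacian (\<lambda>z. L z $ i $ j) z" for i j
    using laplacian_linear_comp[OF open_D z bounded_linear_entry smooth_L] by simp
  have mult: "laplacian (\<lambda>z. c * g z) z = c * laplacian g z" if "smooth_on D g" for c and g :: "complex \<Rightarrow> complex"
    by (rule laplacian_linear_comp[OF open_D z bounded_linear_mult_right that])
  have "laplacian (\<lambda>z. e * cnj (w z)) z = e * cnj (laplacian w z)"
    unfolding mult[OF smooth_on_cnj[OF open_D smooth_w]]
    by (simp add: laplacian_linear_comp[OF open_D z bounded_linear_cnj smooth_w])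
  \<comment> \<open>Reality of the factor lets it pass through the conjugation in the lower left
    entry.\<close>
  moreover have "cnj (\<mu> z) = \<mu> z" using e by (auto simp: \<mu>_def mult.commute)
  ultimately show ?thesis
    by (simp add: cmat_eq_iff entry L_nth mult[OF smooth_s] mult[OF smooth_s, of "- \<i>", simplified]
        laplacian_s[OF z] laplacian_w[OF z] cscale_def)
qed

lemma L_in_orbit:
  assumes z: "z \<in> D"
  shows "L z \<in> geodesic_orbit e"
    and "\<i> *\<^sub>C (mat2 (a z) (b z) (e * cnj (b z)) (cnj (a z)) ** e1 **
      matrix_inv (mat2 (a z) (b z) (e * cnj (b z)) (cnj (a z)))) = L z"
proof -
  show "\<i> *\<^sub>C (mat2 (a z) (b z) (e * cnj (b z)) (cnj (a z)) ** e1 **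
      matrix_inv (mat2 (a z) (b z) (e * cnj (b z)) (cnj (a z)))) = L z"
    unfolding L_def s_def w_def by (rule special_group_orbit_point[OF refl unit[OF z] e])
  then show "L z \<in> geodesic_orbit e"
    unfolding geodesic_orbit_def by (rule image_eqI[OF sym]) (use unit[OF z] in \<open>auto simp: special_group_def\<close>)
qed

text \<open>The Laplacian is a multiple of the position vector, which any multiple of the trace form
  makes orthogonal to the tangent space.\<close>

lemma harmonic:
  assumes "\<And>A B. form A B = c * trace (A ** B)"
  shows "harmonic_into D (geodesic_orbit e) form L"
  unfolding harmonic_into_def
proof (intro conjI ballI smooth_L)
  show "L ` D \<subseteq> geodesic_orbit e" using L_in_orbit by auto
  fix z v assume z: "z \<in> D" and v: "v \<in> tangent_space (geodesic_orbit e) (L z)"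
  have "trace (L z ** v) = 0"
    by (rule trace_mult_tangent_space[OF v trace_geodesic_orbit_square[OF _ e]])
  then show "form (laplacian L z) v = 0"
    by (simp add: assms laplacian_L[OF z] trace_def sum_2 cscale_def matrix_matrix_mult_def mult.assoc
        flip: distrib_left)
qed

section \<open>Wirtinger derivatives, Hopf differential and local invertibility\<close>

definition "s_z z = 2 * (e * a z * cnj (b z) * \<beta> z + cnj (a z) * b z * \<gamma> z)"
definition "w_z z = - 2 * \<i> * ((a z)\<^sup>2 * \<beta> z + (b z)\<^sup>2 * \<gamma> z)"
definition "w_zbar z = - 2 * \<i> * e * ((a z)\<^sup>2 * cnj (\<gamma> z) + (b z)\<^sup>2 * cnj (\<beta> z))"

lemma deriv_s: "z \<in> D \<Longrightarrow> (s has_derivative (\<lambda>v. s_z z * v + cnj (s_z z) * cnj v)) (at z)"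
  and deriv_w: "z \<in> D \<Longrightarrow> (w has_derivative (\<lambda>v. w_z z * v + w_zbar z * cnj v)) (at z)"
proof -
  assume z: "z \<in> D"
  note cnj = bounded_linear.has_derivative[OF bounded_linear_cnj]
  show "(s has_derivative (\<lambda>v. s_z z * v + cnj (s_z z) * cnj v)) (at z)"
    unfolding s_def[abs_def] using e
    by (auto intro!: derivative_eq_intros cnj deriv_a[OF z] deriv_b[OF z] simp: s_z_def fun_eq_iff algebra_simps)
  show "(w has_derivative (\<lambda>v. w_z z * v + w_zbar z * cnj v)) (at z)"
    unfolding w_def[abs_def] using e
    by (auto intro!: derivative_eq_intros deriv_a[OF z] deriv_b[OF z]
      simp: w_z_def w_zbar_def fun_eq_iff power2_eq_square algebra_simps)
qed

text \<open>Conjugating by the frame turns \<open>d_z L\<close> into \<open>\<i>\<close> times the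
  commutator of \<open>U\<close> with \<open>e1\<close>. This has zero diagonal and off-diagonal
  entries proportional to \<open>\<beta>\<close> and \<open>\<gamma>\<close>, so its square has
  trace proportional to their product.\<close>

lemma trace_square_d_z:
  assumes z: "z \<in> D"
  shows "trace (d_z L z ** d_z L z) = 8 * \<beta> z * \<gamma> z"
proof -
  have nth: "dx L z $ i $ j = dx (\<lambda>z. L z $ i $ j) z" "dy L z $ i $ j = dy (\<lambda>z. L z $ i $ j) z" for i j
    using dx_linear_comp[OF bounded_linear_entry smooth_on_differentiable[OF smooth_L z]] by simp_all
  have half: "d_z L z $ i $ j = p" if "((\<lambda>z. L z $ i $ j) has_derivative (\<lambda>v. p * v + q * cnj v)) (at z)" for i j p q
  proof -
    have "dx (\<lambda>z. L z $ i $ j) z = p + q" "\<i> * dy (\<lambda>z. L z $ i $ j) z = q - p"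
      by (simp_all add: directional_derivatives_eq[OF that] right_diff_distrib mult.left_commute[of \<i>])
    then show ?thesis by (simp add: d_z_def cscale_def nth)
  qed
  have 1: "d_z L z $ 1 $ 1 = \<i> * s_z z"
    by (rule half[where q = "\<i> * cnj (s_z z)"])
      (auto intro!: derivative_eq_intros deriv_s[OF z] simp: L_nth algebra_simps)
  have 2: "d_z L z $ 2 $ 2 = - \<i> * s_z z"
    by (rule half[where q = "- \<i> * cnj (s_z z)"])
      (auto intro!: derivative_eq_intros deriv_s[OF z] simp: L_nth algebra_simps)
  have 3: "d_z L z $ 1 $ 2 = w_z z"
    by (rule half[where q = "w_zbar z"]) (simp add: L_nth deriv_w[OF z])
  have 4: "d_z L z $ 2 $ 1 = e * cnj (w_zbar z)"
    by (rule half[where q = "e * cnj (w_z z)"])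
      (auto intro!: derivative_eq_intros bounded_linear.has_derivative[OF bounded_linear_cnj] deriv_w[OF z]
        simp: L_nth algebra_simps)
  have "trace (d_z L z ** d_z L z) = 8 * \<beta> z * \<gamma> z * (a z * cnj (a z) - e * b z * cnj (b z))\<^sup>2"
    using e by (auto simp: trace_def sum_2 matrix_matrix_mult_def 1 2 3 4 s_z_def w_z_def w_zbar_def
        power2_eq_square algebra_simps)
  then show ?thesis by (simp add: unit[OF z])
qed

text \<open>Near \<open>L z0\<close> the orbit carries the chart of \<open>quadric_rotation\<close>
  centred at \<open>L z0\<close>. In this chart the differential of \<open>L\<close> at
  \<open>z0\<close> has Wirtinger coefficients of moduli 2|\<open>\<beta>\<close>| and
  2|\<open>\<gamma>\<close>|, so \<open>nondegenerate\<close> allows a smooth local inverse.\<close>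

lemma local_diffeo: "local_diffeo_into D (geodesic_orbit e) L"
  unfolding local_diffeo_into_def
proof (intro conjI ballI smooth_L)
  show "L ` D \<subseteq> geodesic_orbit e" using L_in_orbit by auto
  fix z0 assume z0: "z0 \<in> D"
  define a0 b0 where "a0 = a z0" and "b0 = b z0"
  have unit0: "a0 * cnj a0 - e * b0 * cnj b0 = 1" using unit[OF z0] by (simp add: a0_def b0_def)
  \<comment> \<open>\<open>T\<close> and \<open>C\<close> are the rotated coordinates
    \<open>s'\<close> and \<open>w'\<close> of \<open>quadric_rotation\<close> for the frame at
    \<open>z0\<close>.\<close>
  define T where "T = (\<lambda>s w. (a0 * cnj a0 + e * b0 * cnj b0) * s + \<i> * e * (a0 * b0 * cnj w - cnj a0 * cnj b0 * w))"
  define C where "C = (\<lambda>s w. (cnj a0)\<^sup>2 * w - e * b0\<^sup>2 * cnj w + 2 * \<i> * cnj a0 * b0 * s)"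
  \<comment> \<open>These extend \<open>Re T\<close> and \<open>C\<close> real-linearly to all
    matrices, reading \<open>s\<close> as \<open>- \<i> * X$1$1\<close> and \<open>cnj w\<close> as
    \<open>e * X$2$1\<close>; the inverse of \<open>L\<close> thereby gets a smooth ambient
    extension.\<close>
  define T' where "T' = (\<lambda>X::cmat. Re (- \<i> * (a0 * cnj a0 + e * b0 * cnj b0) * X$1$1
    + \<i> * (a0 * b0 * X$2$1 - e * cnj a0 * cnj b0 * X$1$2)))"
  define C' where "C' = (\<lambda>X::cmat. (cnj a0)\<^sup>2 * X$1$2 - b0\<^sup>2 * X$2$1 + 2 * cnj a0 * b0 * X$1$1)"
  have C': "C' (quadric_point e s w) = C s w" and T': "T' (quadric_point e s w) = Re (T s w)" for s w
    using e by (auto simp: C'_def C_def T'_def T_def quadric_point_def algebra_simps)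
  define p where "p = (\<lambda>z. (cnj a0)\<^sup>2 * w_z z - e * b0\<^sup>2 * cnj (w_zbar z) + 2 * \<i> * cnj a0 * b0 * s_z z)"
  define q where "q = (\<lambda>z. (cnj a0)\<^sup>2 * w_zbar z - e * b0\<^sup>2 * cnj (w_z z) + 2 * \<i> * cnj a0 * b0 * cnj (s_z z))"
  \<comment> \<open>The chart is injective only where the rotated first coordinate has a fixed sign;
    the positive side is the one containing \<open>L z0\<close>, where its value is 1.\<close>
  define D' where "D' = D \<inter> (\<lambda>z. T' (L z)) -` {0<..}"
  have contT': "continuous_on UNIV T'" and contC': "continuous_on UNIV C'"
    unfolding T'_def C'_def
    by (intro continuous_intros bounded_linear.continuous_on[OF bounded_linear_entry])+
  have "open D'"
    unfolding D'_def by (rule continuous_open_preimage[OF continuous_on_compose2[OF contT' smooth_on_continuous_on[OF smooth_L]] open_D])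
      auto
  have "T (s z0) (w z0) = (a0 * cnj a0 - e * b0 * cnj b0)\<^sup>2"
    using e by (auto simp: T_def s_def w_def a0_def b0_def power2_eq_square algebra_simps)
  then have "T' (L z0) = 1" unfolding L_def T' by (simp add: unit0)
  then have "z0 \<in> D'" using z0 by (simp add: D'_def)
  have "D' \<subseteq> D" by (auto simp: D'_def)
  obtain W H where W: "open W" "z0 \<in> W" "W \<subseteq> D'" "open ((\<lambda>z. C (s z) (w z)) ` W)"
      "smooth_on ((\<lambda>z. C (s z) (w z)) ` W) H" "\<And>z. z \<in> W \<Longrightarrow> H (C (s z) (w z)) = z"
  proof (rule smooth_local_inverse[OF \<open>open D'\<close> \<open>z0 \<in> D'\<close>, of "\<lambda>z. C (s z) (w z)" p q])
    show "((\<lambda>z. C (s z) (w z)) has_derivative (\<lambda>v. p z * v + q z * cnj v)) (at z)" if "z \<in> D'" for z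
    proof -
      have z: "z \<in> D" using that \<open>D' \<subseteq> D\<close> by auto
      show ?thesis
        unfolding C_def
        by (auto intro!: derivative_eq_intros bounded_linear.has_derivative[OF bounded_linear_cnj]
            deriv_s[OF z] deriv_w[OF z] simp: p_def q_def fun_eq_iff algebra_simps)
    qed
    show "smooth_on D' p" "smooth_on D' q"
      unfolding p_def q_def s_z_def w_z_def w_zbar_def power2_eq_square
      by (intro smooth_on_subset[OF _ \<open>D' \<subseteq> D\<close>] smooth_on_intros open_D smooth_a smooth_b smooth_beta smooth_gamma)+
    have "p z0 = - 2 * \<i> * \<beta> z0 * (a0 * cnj a0 - e * b0 * cnj b0)\<^sup>2"
      using e by (auto simp: p_def s_z_def w_z_def w_zbar_def a0_def b0_def power2_eq_square algebra_simps)
    moreover have "q z0 = - 2 * \<i> * e * cnj (\<gamma> z0) * (a0 * cnj a0 - e * b0 * cnj b0)\<^sup>2"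
      using e by (auto simp: q_def s_z_def w_z_def w_zbar_def a0_def b0_def power2_eq_square algebra_simps)
    ultimately have "cmod (p z0) = 2 * cmod (\<beta> z0)" "cmod (q z0) = 2 * cmod (\<gamma> z0)"
      using e unit0 by (auto simp: norm_mult)
    then show "cmod (p z0) \<noteq> cmod (q z0)" using nondegenerate[OF z0] by simp
  qed blast
  define CW where "CW = (\<lambda>z. C (s z) (w z)) ` W"
  \<comment> \<open>An orbit point in \<open>Y\<close> shares its chart value with some
    \<open>L z\<close>, \<open>z \<in> W\<close>, on the same positive side, so chart injectivity
    identifies the two.\<close>
  define Y where "Y = {X. T' X > 0} \<inter> C' -` CW"
  have "open Y"
    unfolding Y_def CW_def
    by (intro open_Int open_Collect_less continuous_intros contT' open_vimage W(4) contC')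
  have LW: "L ` W = Y \<inter> geodesic_orbit e"
  proof (intro subset_antisym subsetI)
    fix X assume "X \<in> L ` W"
    then obtain z where z: "z \<in> W" "X = L z" by auto
    then have "z \<in> D'" using W(3) by auto
    then show "X \<in> Y \<inter> geodesic_orbit e"
      using z L_in_orbit(1)[of z] by (auto simp: Y_def D'_def CW_def L_def C')
  next
    fix X assume X: "X \<in> Y \<inter> geodesic_orbit e"
    then obtain s1 w1 where 1: "X = quadric_point e s1 w1" "cnj s1 = s1" "s1 * s1 - e * w1 * cnj w1 = 1"
      using geodesic_orbit_quadric[OF _ e] by (metis IntD2)
    obtain z where z: "z \<in> W" "C s1 w1 = C (s z) (w z)"
      using X by (auto simp: Y_def CW_def 1(1) C')
    have zD: "z \<in> D'" "z \<in> D" using z(1) W(3) \<open>D' \<subseteq> D\<close> by auto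
    have pos: "Re (T s1 w1) > 0" "Re (T (s z) (w z)) > 0"
      using X zD(1) by (auto simp: Y_def 1(1) T' D'_def L_def)
    have "s1 = s z" "w1 = w z"
      using quadric_chart_inj[OF e unit0 1(2,3) cnj_s quadric[OF zD(2)] T_def C_def pos z(2)] by auto
    then show "X \<in> L ` W" using z(1) 1(1) by (auto simp: L_def)
  qed
  have "smooth_on Y (\<lambda>X. H (C' X))"
  proof (rule smooth_on_compose[OF \<open>open Y\<close> W(4) _ W(5)])
    have "smooth_on Y (\<lambda>X. X)" by (auto simp: smooth_on_def ck_on_id[OF \<open>open Y\<close>])
    then show "smooth_on Y C'" unfolding C'_def by (intro smooth_on_intros \<open>open Y\<close>)
    show "C' ` Y \<subseteq> (\<lambda>z. C (s z) (w z)) ` W" by (auto simp: Y_def CW_def)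
  qed
  moreover have "\<forall>z\<in>W. H (C' (L z)) = z" using W(6) by (simp add: L_def C')
  ultimately show "\<exists>W Y G. open W \<and> z0 \<in> W \<and> W \<subseteq> D \<and> open Y \<and> L ` W = Y \<inter> geodesic_orbit e \<and>
      smooth_on Y (G :: cmat \<Rightarrow> complex) \<and> (\<forall>w\<in>W. G (L w) = w)"
    using W(1-3) \<open>D' \<subseteq> D\<close> \<open>open Y\<close> LW by blast
qed

end

section \<open>Transfer between maps that agree on an open domain\<close>

lemma laplacian_cong:
  assumes "open D" "z \<in> D" "\<And>z. z \<in> D \<Longrightarrow> f z = g z" "smooth_on D f"
  shows "laplacian g z = laplacian f z"
proof -
  have 1: "dx f z = dx g z" "dy f z = dy g z" if "z \<in> D" for z
    using dx_cong[OF assms(1) that assms(3) smooth_on_differentiable[OF assms(4) that]] by simp_all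
  show ?thesis
    using dx_cong(1)[OF assms(1,2) 1(1) smooth_on_differentiable[OF smooth_on_dx[OF assms(4)] assms(2)]]
      dx_cong(2)[OF assms(1,2) 1(2) smooth_on_differentiable[OF smooth_on_dy[OF assms(4)] assms(2)]]
    by (simp add: laplacian_def)
qed

lemma harmonic_into_cong:
  assumes "open D" "\<And>z. z \<in> D \<Longrightarrow> f z = g z" "harmonic_into D N B f"
  shows "harmonic_into D N B g"
  using assms(3) smooth_on_cong[OF assms(1,2)] laplacian_cong[OF assms(1) _ assms(2)] assms(2)
  unfolding harmonic_into_def by (auto simp: image_subset_iff)

lemma local_diffeo_into_cong:
  assumes "open D" "\<And>z. z \<in> D \<Longrightarrow> f z = g z" "local_diffeo_into D N f"
  shows "local_diffeo_into D N g"
  unfolding local_diffeo_into_def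
proof (intro conjI ballI)
  show "smooth_on D g" using smooth_on_cong[OF assms(1,2)] assms(3) by (simp add: local_diffeo_into_def)
  show "g ` D \<subseteq> N" using assms(2,3) by (auto simp: local_diffeo_into_def image_subset_iff)
  fix z assume "z \<in> D"
  then obtain W Y and G :: "cmat \<Rightarrow> complex" where *: "open W" "z \<in> W" "W \<subseteq> D" "open Y"
      "f ` W = Y \<inter> N" "smooth_on Y G" "\<forall>w\<in>W. G (f w) = w"
    using assms(3) unfolding local_diffeo_into_def by blast
  then have "g ` W = Y \<inter> N" "\<forall>w\<in>W. G (g w) = w"
    using assms(2) by (auto simp: image_def subset_iff set_eq_iff)
  then show "\<exists>W Y G. open W \<and> z \<in> W \<and> W \<subseteq> D \<and> open Y \<and> g ` W = Y \<inter> N \<and>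
      smooth_on Y (G :: cmat \<Rightarrow> complex) \<and> (\<forall>w\<in>W. G (g w) = w)"
    using * by blast
qed

lemma d_z_cong:
  assumes "open D" "z \<in> D" "\<And>z. z \<in> D \<Longrightarrow> f z = g z" "smooth_on D f"
  shows "d_z g z = d_z f z"
  using dx_cong[OF assms(1-3) smooth_on_differentiable[OF assms(4,2)]] by (simp add: d_z_def)

subsection \<open>Smoothness of the Klotz data\<close>

lemma mink_entries: "mink X Y = (X$1$2 * Y$2$1 + X$2$1 * Y$1$2 - X$1$1 * Y$2$2 - X$2$2 * Y$1$1) / 2"
  by (simp add: mink_def coord_def trace_def sum_2 e0_def e1_def e2_def e3_def mat_def
      matrix_matrix_mult_def field_simps)

text \<open>\<open>Q\<close> is quadratic in first derivatives of \<open>f\<close>, and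
  \<open>exp u\<close> can be solved for from the two fundamental forms. As it is positive,
  \<open>ln\<close> then gives smoothness of \<open>u\<close>.\<close>

lemma klotz_data_smooth:
  assumes "open D" "smooth_on D f" "smooth_on D n" "\<sigma> > 0" "klotz_data D f n \<sigma> Q u"
  shows "smooth_on D Q" "smooth_on D u"
proof -
  note intros = smooth_on_intros assms(1) smooth_on_dx[OF assms(2)] smooth_on_dy[OF assms(2)] smooth_on_dx[OF assms(3)]
  have dz: "smooth_on D (\<lambda>z. d_z f z $ i $ j)" for i j
    unfolding d_z_def cscale_def by (simp, intro intros)
  have "smooth_on D (\<lambda>z. mink (d_z f z) (d_z f z))"
    unfolding mink_entries by (intro smooth_on_intros assms(1) dz)
  then show Q: "smooth_on D Q"
    by (rule smooth_on_cong[OF assms(1), rotated]) (use assms(5) in \<open>simp add: klotz_data_def\<close>)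
  \<comment> \<open>Half the sum of the mixed coefficients of the first form and of the second form
    divided by \<open>\<sigma>\<close>, both read off at \<open>v = 1\<close>, where the
    \<open>Q\<close> terms contribute \<open>2 * Re (Q z)\<close>.\<close>
  define E where "E = (\<lambda>z. (Re (mink (dx f z) (dx f z)) - 2 * Re (Q z) - Re (mink (dx f z) (dx n z)) / \<sigma>) / 2)"
  have "smooth_on D E"
    unfolding E_def mink_entries by (intro intros Q)
  have E: "E z = exp (u z)" if z: "z \<in> D" for z
  proof -
    have k: "complex_of_real (fff f z 1 1) = Q z * 1\<^sup>2 + of_real (exp (u z) + (cmod (Q z))\<^sup>2 * exp (- u z)) * (1 * cnj 1)
              + cnj (Q z) * (cnj 1)\<^sup>2"
       "complex_of_real (sff f n z 1 1) = of_real (\<sigma> * (exp (u z) - (cmod (Q z))\<^sup>2 * exp (- u z))) * (1 * cnj 1)"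
      using assms(5) z unfolding klotz_data_def by blast+
    have "fff f z 1 1 = 2 * Re (Q z) + (exp (u z) + (cmod (Q z))\<^sup>2 * exp (- u z))"
      using arg_cong[OF k(1), of Re] by simp
    moreover have "sff f n z 1 1 = \<sigma> * (exp (u z) - (cmod (Q z))\<^sup>2 * exp (- u z))"
      using arg_cong[OF k(2), of Re] by simp
    then have "sff f n z 1 1 / \<sigma> = exp (u z) - (cmod (Q z))\<^sup>2 * exp (- u z)"
      using assms(4) by simp
    ultimately have "(fff f z 1 1 - 2 * Re (Q z) + sff f n z 1 1 / \<sigma>) / 2 = exp (u z)" by simp
    then show ?thesis by (simp add: E_def fff_def sff_def dx_def)
  qed
  have "smooth_on D (\<lambda>z. ln (E z))"
    by (rule smooth_on_compose[OF assms(1) _ \<open>smooth_on D E\<close> smooth_on_ln]) (auto simp: E)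
  then show "smooth_on D u"
    by (rule smooth_on_cong[OF assms(1), rotated]) (simp add: E)
qed

lemma smooth_on_exp: "open D \<Longrightarrow> smooth_on D (g :: complex \<Rightarrow> real) \<Longrightarrow> smooth_on D (\<lambda>z. exp (g z))"
  by (rule smooth_on_compose[OF _ open_UNIV _ smooth_on_exp_real]) auto

subsection \<open>The extended frame\<close>

lemma U_form_mat2: "U_form \<sigma> Q u lam z =
    (let p = of_real ((1 + \<sigma>) / 2) * inverse lam in
      mat2 (du_z u z / 4) (\<i> * p * of_real (exp (u z / 2))) (- \<i> * p * Q z * of_real (exp (- u z / 2))) (- du_z u z / 4))"
  and V_form_mat2: "V_form \<sigma> Q u lam z =
    (let q = of_real ((1 - \<sigma>) / 2) * lam in
      mat2 (- du_zbar u z / 4) (\<i> * q * cnj (Q z) * of_real (exp (- u z / 2))) (- \<i> * q * of_real (exp (u z / 2))) (du_zbar u z / 4))"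
  by (simp_all add: U_form_def V_form_def basis_mat2 mat2_simps Let_def algebra_simps)

lemma du_zbar_eq_cnj: "du_zbar u z = cnj (du_z u z)"
  by (simp add: du_z_def du_zbar_def)

lemma extended_frame_has_derivative:
  assumes "extended_frame D zb \<sigma> Q u \<Psi>" "lam \<noteq> 0" "z \<in> D"
  shows "(\<Psi> lam has_derivative (\<lambda>v. \<Psi> lam z ** (v *\<^sub>C U_form \<sigma> Q u lam z + cnj v *\<^sub>C V_form \<sigma> Q u lam z))) (at z)"
proof -
  have det: "det (\<Psi> lam z) = 1" and diff: "\<Psi> lam differentiable (at z)"
    and mc: "\<And>v. matrix_inv (\<Psi> lam z) ** frechet_derivative (\<Psi> lam) (at z) v =
              v *\<^sub>C U_form \<sigma> Q u lam z + cnj v *\<^sub>C V_form \<sigma> Q u lam z"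
    using assms by (auto simp: extended_frame_def SL2C_def)
  have "frechet_derivative (\<Psi> lam) (at z) v =
      \<Psi> lam z ** (matrix_inv (\<Psi> lam z) ** frechet_derivative (\<Psi> lam) (at z) v)" for v
    using det by (simp add: matrix_mul_assoc matrix_inv_cancel)
  then have "frechet_derivative (\<Psi> lam) (at z) =
      (\<lambda>v. \<Psi> lam z ** (v *\<^sub>C U_form \<sigma> Q u lam z + cnj v *\<^sub>C V_form \<sigma> Q u lam z))"
    unfolding mc by (rule ext)
  with diff show ?thesis unfolding frechet_derivative_works by simp
qed

text \<open>The hypothesis \<open>real\<close> is the reality condition that puts \<open>U dz + V dzbar\<close> into
  \<open>su(1,1)\<close> respectively \<open>su(2)\<close>; the frame then stays in the corresponding group because it
  starts at the identity.\<close>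

lemma special_frame_of_extended_frame:
  assumes "open D" "connected D" "zb \<in> D" "smooth_on D Q" "smooth_on D u"
    and nd: "\<forall>z\<in>D. exp (2 * u z) > (cmod (Q z))\<^sup>2"
    and fr: "extended_frame D zb \<sigma> Q u \<Psi>" and lam: "lam \<noteq> 0"
    and p: "p = of_real ((1 + \<sigma>) / 2) * inverse lam" "p \<noteq> 0"
    and e: "e = 1 \<or> e = -1"
    and real: "of_real ((1 - \<sigma>) / 2) * lam = e * cnj p"
  shows "special_frame D e (\<lambda>z. du_z u z / 4) (\<lambda>z. \<i> * p * of_real (exp (u z / 2)))
      (\<lambda>z. - \<i> * p * Q z * of_real (exp (- u z / 2))) (\<lambda>z. \<Psi> lam z $ 1 $ 1) (\<lambda>z. \<Psi> lam z $ 1 $ 2)"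
    and "\<And>z. z \<in> D \<Longrightarrow> \<Psi> lam z = mat2 (\<Psi> lam z $ 1 $ 1) (\<Psi> lam z $ 1 $ 2)
      (e * cnj (\<Psi> lam z $ 1 $ 2)) (cnj (\<Psi> lam z $ 1 $ 1))"
proof -
  define \<omega> \<beta> \<gamma> where "\<omega> = (\<lambda>z. du_z u z / 4)" and "\<beta> = (\<lambda>z. \<i> * p * complex_of_real (exp (u z / 2)))"
    and "\<gamma> = (\<lambda>z. - \<i> * p * Q z * complex_of_real (exp (- u z / 2)))"
  define \<eta> \<theta> where "\<eta> = (\<lambda>z v. v * \<omega> z - cnj v * cnj (\<omega> z))" and "\<theta> = (\<lambda>z v. v * \<beta> z + e * cnj v * cnj (\<gamma> z))"
  define a b c d where "a = (\<lambda>z. \<Psi> lam z $ 1 $ 1)" and "b = (\<lambda>z. \<Psi> lam z $ 1 $ 2)"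
    and "c = (\<lambda>z. \<Psi> lam z $ 2 $ 1)" and "d = (\<lambda>z. \<Psi> lam z $ 2 $ 2)"
  have form: "v *\<^sub>C U_form \<sigma> Q u lam z + cnj v *\<^sub>C V_form \<sigma> Q u lam z =
      mat2 (\<eta> z v) (\<theta> z v) (e * cnj (\<theta> z v)) (- \<eta> z v)" for z v
    unfolding U_form_mat2 V_form_mat2 real p(1)[symmetric] Let_def using e
    by (auto simp: mat2_simps \<eta>_def \<theta>_def \<omega>_def \<beta>_def \<gamma>_def du_zbar_eq_cnj algebra_simps)
  have entry: "((\<lambda>z. \<Psi> lam z $ i $ j) has_derivative
      (\<lambda>v. (\<Psi> lam z ** mat2 (\<eta> z v) (\<theta> z v) (e * cnj (\<theta> z v)) (- \<eta> z v)) $ i $ j)) (at z)" if "z \<in> D" for z i j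
    using bounded_linear.has_derivative[OF bounded_linear_entry extended_frame_has_derivative[OF fr lam that]]
    unfolding form .
  have da: "(a has_derivative (\<lambda>v. a z * \<eta> z v + e * b z * cnj (\<theta> z v))) (at z)"
    and db: "(b has_derivative (\<lambda>v. a z * \<theta> z v - b z * \<eta> z v)) (at z)"
    and dc: "(c has_derivative (\<lambda>v. c z * \<eta> z v + e * d z * cnj (\<theta> z v))) (at z)"
    and dd: "(d has_derivative (\<lambda>v. c z * \<theta> z v - d z * \<eta> z v)) (at z)" if "z \<in> D" for z
    using entry[OF that, of 1 1] entry[OF that, of 1 2] entry[OF that, of 2 1] entry[OF that, of 2 2]
    by (simp_all add: a_def b_def c_def d_def matrix_matrix_mult_def sum_2 algebra_simps)
  have det: "a z * d z - b z * c z = 1" if "z \<in> D" for z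
    using fr lam that by (auto simp: extended_frame_def SL2C_def det_2 a_def b_def c_def d_def)
  have init: "a zb = 1" "b zb = 0" "c zb = 0" "d zb = 1"
    using fr lam by (simp_all add: extended_frame_def a_def b_def c_def d_def mat_def)
  have \<eta>: "cnj (\<eta> z v) = - \<eta> z v" for z v by (simp add: \<eta>_def)
  note cnj = bounded_linear.has_derivative[OF bounded_linear_cnj]
  \<comment> \<open>With J = diag(1, -e), these are entries of \<Psi> J \<Psi>* up to the factor
    \<open>- e\<close>. They are constant because the Maurer-Cartan form A satisfies A J + J A* =
    0.\<close>
  define X Y where "X = (\<lambda>z. d z * cnj (d z) - e * c z * cnj (c z))" and "Y = (\<lambda>z. b z * cnj (d z) - e * a z * cnj (c z))"
  have "(X has_derivative (\<lambda>v. 0)) (at z)" if "z \<in> D" for z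
    unfolding X_def using e
    by (auto intro!: derivative_eq_intros cnj da db dc dd that simp: \<eta> fun_eq_iff algebra_simps)
  from has_derivative_zero_unique_connected[OF assms(1,2) this _ assms(3)]
  have X: "X z = 1" if "z \<in> D" for z
    using that by (simp add: X_def[THEN fun_cong, of zb] init)
  have "(Y has_derivative (\<lambda>v. 0)) (at z)" if "z \<in> D" for z
    unfolding Y_def using e
    by (auto intro!: derivative_eq_intros cnj da db dc dd that simp: \<eta> fun_eq_iff algebra_simps)
  from has_derivative_zero_unique_connected[OF assms(1,2) this _ assms(3)]
  have Y: "Y z = 0" if "z \<in> D" for z
    using that by (simp add: Y_def[THEN fun_cong, of zb] init)
  have cd: "c z = e * cnj (b z)" "d z = cnj (a z)" if z: "z \<in> D" for z
  proof -
    \<comment> \<open>Inserting the determinant and regrouping expresses the conjugated entries of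
      the second row through the known constants \<open>X = 1\<close> and
      \<open>Y = 0\<close>.\<close>
    have "cnj (d z) = cnj (d z) * (a z * d z - b z * c z)" using det[OF z] by simp
    also have "\<dots> = a z * X z - c z * Y z" by (simp add: X_def Y_def algebra_simps)
    finally have "cnj (d z) = a z" using X[OF z] Y[OF z] by simp
    then show "d z = cnj (a z)" by (metis complex_cnj_cnj)
    have "e * cnj (c z) = e * cnj (c z) * (a z * d z - b z * c z)" using det[OF z] by simp
    also have "\<dots> = b z * X z - d z * Y z" by (simp add: X_def Y_def algebra_simps)
    finally have "e * cnj (c z) = b z" using X[OF z] Y[OF z] by simp
    then have "cnj (b z) = cnj (e * cnj (c z))" by simp
    then show "c z = e * cnj (b z)" using e by auto
  qed
  show "\<Psi> lam z = mat2 (\<Psi> lam z $ 1 $ 1) (\<Psi> lam z $ 1 $ 2)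
      (e * cnj (\<Psi> lam z $ 1 $ 2)) (cnj (\<Psi> lam z $ 1 $ 1))" if "z \<in> D" for z
    using cd[OF that] by (simp add: cmat_eq_iff a_def b_def c_def d_def)
  have su: "smooth_on D (\<lambda>z. complex_of_real (exp (u z / 2)))" "smooth_on D (\<lambda>z. complex_of_real (exp (- u z / 2)))"
    by (intro smooth_on_intros smooth_on_exp assms)+
  have "special_frame D e \<omega> \<beta> \<gamma> a b"
  proof
    show "smooth_on D \<omega>"
      unfolding \<omega>_def du_z_def by (intro smooth_on_intros smooth_on_dx smooth_on_dy assms)
    show "smooth_on D \<beta>" "smooth_on D \<gamma>"
      unfolding \<beta>_def \<gamma>_def by (intro smooth_on_intros su assms)+
    fix z assume z: "z \<in> D"
    show "(a has_derivative (\<lambda>v. a z * (v * \<omega> z - cnj v * cnj (\<omega> z)) +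
        e * b z * (cnj v * cnj (\<beta> z) + e * v * \<gamma> z))) (at z)"
      using da[OF z] e by (auto simp: \<eta>_def \<theta>_def mult.assoc)
    show "(b has_derivative (\<lambda>v. a z * (v * \<beta> z + e * cnj v * cnj (\<gamma> z)) -
        b z * (v * \<omega> z - cnj v * cnj (\<omega> z)))) (at z)"
      using db[OF z] by (simp add: \<eta>_def \<theta>_def)
    show "a z * cnj (a z) - e * b z * cnj (b z) = 1"
      using det[OF z] by (simp add: cd[OF z] algebra_simps)
    \<comment> \<open>Since \<open>\<beta>\<close> is a constant times exp(u/2), its logarithmic
      derivative is half that of \<open>u\<close>, which matches \<open>\<omega>\<close> as a
      quarter of the z-derivative of \<open>u\<close>.\<close>
    have "(\<beta> has_derivative (\<lambda>v. \<beta> z * of_real (frechet_derivative u (at z) v / 2))) (at z)"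
      unfolding \<beta>_def using smooth_on_has_derivative[OF assms(5) z]
      by (auto intro!: derivative_eq_intros simp: fun_eq_iff)
    note d = directional_derivatives_eq[OF this]
    show "dx \<beta> z + \<i> * dy \<beta> z = 4 * cnj (\<omega> z) * \<beta> z"
      unfolding d by (simp add: \<omega>_def du_z_def dx_def[of u] dy_def[of u] field_simps)
    have "(cmod (Q z))\<^sup>2 < (exp (u z))\<^sup>2" using nd z by (simp add: exp_double)
    then have "cmod (Q z) < exp (u z)" by (rule power_less_imp_less_base) simp
    then have "cmod (Q z) * exp (- u z / 2) < exp (u z) * exp (- u z / 2)" by simp
    also have "\<dots> = exp (u z / 2)" by (simp flip: exp_add)
    finally show "cmod (\<gamma> z) < cmod (\<beta> z)"
      using p(2) by (simp add: \<beta>_def \<gamma>_def norm_mult)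
  qed (use assms(1) e in auto)
  then show "special_frame D e (\<lambda>z. du_z u z / 4) (\<lambda>z. \<i> * p * of_real (exp (u z / 2)))
      (\<lambda>z. - \<i> * p * Q z * of_real (exp (- u z / 2))) (\<lambda>z. \<Psi> lam z $ 1 $ 1) (\<lambda>z. \<Psi> lam z $ 1 $ 2)"
    unfolding \<omega>_def \<beta>_def \<gamma>_def a_def b_def .
qed

section \<open>Umbilicity of the associated surfaces\<close>

lemma ctransp_mult: "ctransp (A ** B) = ctransp B ** ctransp A"
  by (simp add: cmat_eq_iff ctransp_def matrix_matrix_mult_def sum_2 mult.commute)

lemma bounded_linear_ctransp: "bounded_linear ctransp"
  unfolding linear_conv_bounded_linear[symmetric]
  by (auto intro!: linearI simp: ctransp_def cmat_eq_iff)

text \<open>For vanishing \<open>Q\<close> the frame equation gives dn = -\<sigma> df, so the shape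
  operator is \<open>\<sigma>\<close> times the identity. The contrapositive yields a point with
  \<open>Q z \<noteq> 0\<close>.\<close>

lemma totally_umbilic_assoc_surface:
  assumes fr: "extended_frame D zb \<sigma> Q u \<Psi>" and lam: "cmod lam = 1" and Q: "\<And>z. z \<in> D \<Longrightarrow> Q z = 0"
  shows "totally_umbilic D (assoc_surface \<Psi> lam) (assoc_normal \<Psi> lam)"
  unfolding totally_umbilic_def
proof
  fix z assume z: "z \<in> D"
  have "lam \<noteq> 0" using lam by auto
  have "lam * cnj lam = 1" using lam by (simp add: complex_norm_square[symmetric])
  then have inv: "inverse lam = cnj lam" by (rule inverse_unique)
  define A where "A = (\<lambda>v. v *\<^sub>C U_form \<sigma> Q u lam z + cnj v *\<^sub>C V_form \<sigma> Q u lam z)"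
  have deriv: "((\<lambda>z. \<Psi> lam z ** M ** ctransp (\<Psi> lam z)) has_derivative
      (\<lambda>v. \<Psi> lam z ** (A v ** M + M ** ctransp (A v)) ** ctransp (\<Psi> lam z))) (at z)" for M
  proof -
    have d: "(\<Psi> lam has_derivative (\<lambda>v. \<Psi> lam z ** A v)) (at z)"
      unfolding A_def by (rule extended_frame_has_derivative[OF fr \<open>lam \<noteq> 0\<close> z])
    have "((\<lambda>z. \<Psi> lam z ** M) has_derivative (\<lambda>v. \<Psi> lam z ** A v ** M)) (at z)"
      by (rule bounded_linear.has_derivative[OF bounded_bilinear.bounded_linear_left[OF bounded_bilinear_cmat_mult] d])
    from bounded_bilinear.FDERIV[OF bounded_bilinear_cmat_mult this
        bounded_linear.has_derivative[OF bounded_linear_ctransp d]]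
    show ?thesis
      by (rule has_derivative_eq_rhs)
        (simp add: fun_eq_iff ctransp_mult matrix_add_ldistrib bounded_bilinear.add_left[OF bounded_bilinear_cmat_mult] matrix_mul_assoc)
  qed
  have df: "frechet_derivative (assoc_surface \<Psi> lam) (at z) v =
      \<Psi> lam z ** (A v ** e0 + e0 ** ctransp (A v)) ** ctransp (\<Psi> lam z)" for v
    using frechet_derivative_eq[OF deriv[of e0]] by (simp add: assoc_surface_def[abs_def])
  have dn: "frechet_derivative (assoc_normal \<Psi> lam) (at z) v =
      \<Psi> lam z ** (A v ** e1 + e1 ** ctransp (A v)) ** ctransp (\<Psi> lam z)" for v
    using frechet_derivative_eq[OF deriv[of e1]] by (simp add: assoc_normal_def[abs_def])
  \<comment> \<open>The diagonal of \<open>A v\<close> is imaginary and cancels on both sides. Off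
    the diagonal, \<open>inverse lam = cnj lam\<close> gives the coefficients (1 + \<sigma>)/2 and
    (1 - \<sigma>)/2 a common factor; \<open>e0\<close> adds them to 1, while the signs of
    \<open>e1\<close> combine them to -\<sigma> in the upper right entry.\<close>
  have A: "A v ** e1 + e1 ** ctransp (A v) = of_real (- \<sigma>) *\<^sub>C (A v ** e0 + e0 ** ctransp (A v))" for v
    by (simp add: A_def U_form_mat2 V_form_mat2 Let_def Q[OF z] inv mat2_simps basis_mat2 mat2_mult
        du_zbar_eq_cnj add_divide_distrib diff_divide_distrib algebra_simps)
  have "B ** (k *\<^sub>C X) ** C = k *\<^sub>C (B ** X ** C)" for B C X k
    by (simp add: cmat_eq_iff cscale_def matrix_matrix_mult_def sum_2 algebra_simps)
  then have "frechet_derivative (assoc_normal \<Psi> lam) (at z) v =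
      of_real (- \<sigma>) *\<^sub>C frechet_derivative (assoc_surface \<Psi> lam) (at z) v" for v
    unfolding df dn A by simp
  moreover have "mink X (of_real k *\<^sub>C Y) = of_real k * mink X Y" for X Y k
    by (simp add: mink_entries cscale_def algebra_simps)
  ultimately have "sff (assoc_surface \<Psi> lam) (assoc_normal \<Psi> lam) z v w =
      \<sigma> * fff (assoc_surface \<Psi> lam) z v w" for v w
    unfolding sff_def fff_def by (simp del: of_real_minus)
  then show "\<exists>c. \<forall>v w. sff (assoc_surface \<Psi> lam) (assoc_normal \<Psi> lam) z v w =
      c * fff (assoc_surface \<Psi> lam) z v w" by blast
qed

text \<open>The condition \<open>real\<close> makes the frame at \<open>lam0\<close> a special frame
  whose map \<open>L\<close> is the Gauss map, so everything transfers from the locale. The sign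
  \<open>e\<close> and the factor \<open>k\<close> cover both target geometries.\<close>

lemma gauss_map_at_reality_point:
  assumes "open D" "connected D" "zb \<in> D" "smooth_on D Q" "smooth_on D u"
    and nd: "\<forall>z\<in>D. exp (2 * u z) > (cmod (Q z))\<^sup>2"
    and fr: "extended_frame D zb \<sigma> Q u \<Psi>" and "\<sigma> > 0" and "lam0 \<noteq> 0"
    and e: "e = 1 \<or> e = -1"
    and real: "complex_of_real ((1 - \<sigma>) * (cmod lam0)\<^sup>2) = e * of_real (1 + \<sigma>)"
    and form: "\<And>A B. form A B = k * trace (A ** B)" "k \<noteq> 0"
  shows "\<exists>h \<in> SL2C.
      harmonic_into D (geodesic_orbit e) form (\<lambda>z. h ** gauss_map \<Psi> lam0 z ** matrix_inv h) \<and>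
      local_diffeo_into D (geodesic_orbit e) (\<lambda>z. h ** gauss_map \<Psi> lam0 z ** matrix_inv h)"
    and "cmod lam = 1 \<Longrightarrow> \<not> totally_umbilic D (assoc_surface \<Psi> lam) (assoc_normal \<Psi> lam) \<Longrightarrow>
      non_conformal D form (gauss_map \<Psi> lam0)"
proof -
  define p where "p = complex_of_real ((1 + \<sigma>) / 2) * inverse lam0"
  have "p \<noteq> 0" using assms(8,9) by (simp add: p_def flip: of_real_add) 
  have norm: "of_real (1 - \<sigma>) * lam0 * cnj lam0 = e * of_real (1 + \<sigma>)"
    using real by (simp only: of_real_mult complex_norm_square mult.assoc)
  \<comment> \<open>Expanding by \<open>cnj lam0\<close> brings in |lam0|^2, so that
    \<open>real\<close> converts the dzbar coefficient into a conjugate of the dz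
    coefficient.\<close>
  have "of_real ((1 - \<sigma>) / 2) * lam0 = of_real (1 - \<sigma>) * lam0 * cnj lam0 / (2 * cnj lam0)"
    using assms(9) by (subst eq_divide_eq) (simp only: complex_cnj_zero_iff mult_eq_0_iff of_real_divide
        of_real_numeral, simp)
  also have "\<dots> = e * cnj p"
    unfolding norm p_def using assms(9) by (simp add: field_simps)
  finally have "of_real ((1 - \<sigma>) / 2) * lam0 = e * cnj p" .
  note fr' = special_frame_of_extended_frame[OF assms(1-7,9) p_def \<open>p \<noteq> 0\<close> e this]
  interpret special_frame D e "\<lambda>z. du_z u z / 4" "\<lambda>z. \<i> * p * of_real (exp (u z / 2))"
    "\<lambda>z. - \<i> * p * Q z * of_real (exp (- u z / 2))" "\<lambda>z. \<Psi> lam0 z $ 1 $ 1" "\<lambda>z. \<Psi> lam0 z $ 1 $ 2"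
    by (rule fr'(1))
  have L: "L z = gauss_map \<Psi> lam0 z" if "z \<in> D" for z
    using L_in_orbit(2)[OF that] unfolding gauss_map_def fr'(2)[OF that, symmetric] by simp
  have one: "matrix_inv (mat 1 :: cmat) = mat 1"
    using matrix_inv_cancel(2)[of "mat 1 :: cmat"] by simp
  have "mat 1 \<in> SL2C" by (simp add: SL2C_def)
  then show "\<exists>h \<in> SL2C.
      harmonic_into D (geodesic_orbit e) form (\<lambda>z. h ** gauss_map \<Psi> lam0 z ** matrix_inv h) \<and>
      local_diffeo_into D (geodesic_orbit e) (\<lambda>z. h ** gauss_map \<Psi> lam0 z ** matrix_inv h)"
    using harmonic_into_cong[OF open_D L harmonic[OF form(1)]] local_diffeo_into_cong[OF open_D L local_diffeo]
    by (intro bexI[of _ "mat 1"]) (simp_all add: one)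
  show "non_conformal D form (gauss_map \<Psi> lam0)"
    if lam: "cmod lam = 1" and not_umbilic: "\<not> totally_umbilic D (assoc_surface \<Psi> lam) (assoc_normal \<Psi> lam)"
  proof -
    obtain z where z: "z \<in> D" "Q z \<noteq> 0"
      using totally_umbilic_assoc_surface[OF fr lam] not_umbilic by blast
    have d_z: "d_z (gauss_map \<Psi> lam0) z = d_z L z"
      by (rule d_z_cong[where f = L, OF open_D z(1) L smooth_L])
    \<comment> \<open>The exponentials in \<open>\<beta>\<close> and \<open>\<gamma>\<close> cancel,
      so the value is \<open>8 * k * p\<^sup>2 * Q z\<close>.\<close>
    have "form (d_z (gauss_map \<Psi> lam0) z) (d_z (gauss_map \<Psi> lam0) z) \<noteq> 0"
      unfolding form(1) d_z trace_square_d_z[OF z(1)]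
      using z(2) form(2) \<open>p \<noteq> 0\<close> by simp
    then show ?thesis using z(1) by (auto simp: non_conformal_def)
  qed
qed

text \<open>With r = sqrt(1 - \<sigma>^2), cosh t = 1/r gives sinh t = \<sigma>/r. Hence exp t = (1
  + \<sigma>)/r, whose square is (1 + \<sigma>)/(1 - \<sigma>).\<close>

lemma exp_arcosh_sq:
  fixes \<sigma> :: real
  assumes "0 < \<sigma>" "\<sigma> < 1"
  shows "(1 - \<sigma>) * (exp (arcosh (sqrt (- 1 / (- 1 + \<sigma>\<^sup>2)))))\<^sup>2 = 1 + \<sigma>"
proof -
  define r where "r = sqrt (1 - \<sigma>\<^sup>2)"
  have "\<sigma>\<^sup>2 < 1" using assms by (simp add: power_less_one_iff)
  then have r: "r > 0" "r\<^sup>2 = 1 - \<sigma>\<^sup>2" by (simp_all add: r_def)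
  have "- 1 / (- 1 + \<sigma>\<^sup>2) = 1 / (1 - \<sigma>\<^sup>2)" using \<open>\<sigma>\<^sup>2 < 1\<close> by (simp add: field_simps)
  then have x: "sqrt (- 1 / (- 1 + \<sigma>\<^sup>2)) = 1 / r" by (simp add: r_def real_sqrt_divide)
  have "r \<le> 1" by (simp add: r_def)
  then have "1 / r \<ge> 1" using r(1) by simp
  have "(1 / r)\<^sup>2 - 1 = (\<sigma> / r)\<^sup>2" using r by (simp add: field_simps power_divide)
  then have "sqrt ((1 / r)\<^sup>2 - 1) = \<sigma> / r" using assms(1) r(1) by simp
  then have "exp (arcosh (1 / r)) = (1 + \<sigma>) / r"
    using \<open>1 / r \<ge> 1\<close> r(1) assms(1) by (simp add: arcosh_real_def add_pos_pos add_divide_distrib)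
  moreover have "(1 - \<sigma>) * (1 + \<sigma>)\<^sup>2 = (1 + \<sigma>) * r\<^sup>2"
    unfolding r(2) by (simp add: power2_eq_square algebra_simps)
  ultimately show ?thesis
    unfolding x using r(1) by (simp add: power_divide)
qed

text \<open>Now r = sqrt(\<sigma>^2 - 1) and the roles are exchanged: sinh t = 1/r gives cosh t =
  \<sigma>/r, so again exp t = (1 + \<sigma>)/r.\<close>

lemma exp_arsinh_sq:
  fixes \<sigma> :: real
  assumes "1 < \<sigma>"
  shows "(\<sigma> - 1) * (exp (arsinh (sqrt (1 / (- 1 + \<sigma>\<^sup>2)))))\<^sup>2 = 1 + \<sigma>"
proof -
  define r where "r = sqrt (- 1 + \<sigma>\<^sup>2)"
  have "\<sigma>\<^sup>2 > 1" using assms by (simp add: one_less_power)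
  then have r: "r > 0" "r\<^sup>2 = \<sigma>\<^sup>2 - 1" by (simp_all add: r_def)
  have x: "sqrt (1 / (- 1 + \<sigma>\<^sup>2)) = 1 / r" by (simp add: r_def real_sqrt_divide)
  have "(1 / r)\<^sup>2 + 1 = (\<sigma> / r)\<^sup>2" using r by (simp add: field_simps power_divide)
  then have "sqrt ((1 / r)\<^sup>2 + 1) = \<sigma> / r" using assms(1) r(1) by simp
  then have "exp (arsinh (1 / r)) = (1 + \<sigma>) / r"
    using r(1) assms(1) by (simp add: arsinh_real_def add_pos_pos add_divide_distrib)
  moreover have "(\<sigma> - 1) * (1 + \<sigma>)\<^sup>2 = (1 + \<sigma>) * r\<^sup>2"
    unfolding r(2) by (simp add: power2_eq_square algebra_simps)
  ultimately show ?thesis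
    unfolding x using r(1) by (simp add: power_divide)
qed

theorem theorem2:
  fixes D :: "complex set" and zb :: complex
    and f n :: "complex \<Rightarrow> complex^2^2"
    and K \<sigma> :: real
    and Q :: "complex \<Rightarrow> complex" and u :: "complex \<Rightarrow> real"
    and \<Psi> :: "complex \<Rightarrow> complex \<Rightarrow> complex^2^2"
  assumes "open D" and "simply_connected D" and "zb \<in> D"
    and "surface_in_H3 D f n"
    and "\<And>z. z \<in> D \<Longrightarrow> gauss_curvature f n z = K"
    and "K > -1" and "K \<noteq> 0"
    and "\<sigma> > 0" and "K = -1 + \<sigma>\<^sup>2"
    and "sff_conformal D f n" and "positively_oriented D f n"
    and "klotz_data D f n \<sigma> Q u"
    and "extended_frame D zb \<sigma> Q u \<Psi>"
  shows "(-1 < K \<and> K < 0 \<longrightarrow>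
      (\<forall>lam0. lam0 \<notin> cball 0 1 \<and> cmod lam0 = exp (arcosh (sqrt (-1 / K))) \<longrightarrow>
        (\<exists>h \<in> SL2C.
           harmonic_into D H2 H2_form (\<lambda>z. h ** gauss_map \<Psi> lam0 z ** matrix_inv h) \<and>
           local_diffeo_into D H2 (\<lambda>z. h ** gauss_map \<Psi> lam0 z ** matrix_inv h)) \<and>
        (\<forall>lam. cmod lam = 1 \<longrightarrow>
           \<not> totally_umbilic D (assoc_surface \<Psi> lam) (assoc_normal \<Psi> lam) \<longrightarrow>
           non_conformal D H2_form (gauss_map \<Psi> lam0)))) \<and>
    (K > 0 \<longrightarrow>
      (\<forall>lam0. lam0 \<notin> cball 0 1 \<and> cmod lam0 = exp (arsinh (sqrt (1 / K))) \<longrightarrow>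
        (\<exists>h \<in> SL2C.
           harmonic_into D S2 S2_form (\<lambda>z. h ** gauss_map \<Psi> lam0 z ** matrix_inv h) \<and>
           local_diffeo_into D S2 (\<lambda>z. h ** gauss_map \<Psi> lam0 z ** matrix_inv h)) \<and>
        (\<forall>lam. cmod lam = 1 \<longrightarrow>
           \<not> totally_umbilic D (assoc_surface \<Psi> lam) (assoc_normal \<Psi> lam) \<longrightarrow>
           non_conformal D S2_form (gauss_map \<Psi> lam0))))"
proof -
  have smooth: "smooth_on D f" "smooth_on D n" using assms(4) by (auto simp: surface_in_H3_def)
  have nd: "\<forall>z\<in>D. exp (2 * u z) > (cmod (Q z))\<^sup>2"
    using assms(12) by (auto simp: klotz_data_def)
  note main = gauss_map_at_reality_point[OF assms(1) simply_connected_imp_connected[OF assms(2)] assms(3)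
      klotz_data_smooth[OF assms(1) smooth assms(8,12)] nd assms(13,8)]
  have H2_form: "H2_form A B = (1/2) * trace (A ** B)" and S2_form: "S2_form A B = (-1/2) * trace (A ** B)" for A B
    by (simp_all add: H2_form_def S2_form_def)
  have hyp: "complex_of_real ((1 - \<sigma>) * (cmod lam0)\<^sup>2) = 1 * of_real (1 + \<sigma>)"
    if "K < 0" "cmod lam0 = exp (arcosh (sqrt (-1 / K)))" for lam0
  proof -
    have "\<sigma>\<^sup>2 < 1\<^sup>2" using that(1) assms(9) by simp
    then have "\<sigma> < 1" by (rule power_less_imp_less_base) simp
    from exp_arcosh_sq[OF assms(8) this] show ?thesis unfolding that(2) assms(9) by simp
  qed
  \<comment> \<open>Positive curvature means \<open>\<sigma> > 1\<close>, so
    \<open>1 - \<sigma>\<close> is negative; this is where the sign \<open>e = -1\<close> comes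
    from.\<close>
  have sph: "complex_of_real ((1 - \<sigma>) * (cmod lam0)\<^sup>2) = - 1 * of_real (1 + \<sigma>)"
    if "K > 0" "cmod lam0 = exp (arsinh (sqrt (1 / K)))" for lam0
  proof -
    have "1\<^sup>2 < \<sigma>\<^sup>2" using that(1) assms(9) by simp
    then have "1 < \<sigma>" by (rule power_less_imp_less_base) (use assms(8) in simp)
    from exp_arsinh_sq[OF this] have "(1 - \<sigma>) * (cmod lam0)\<^sup>2 = - (1 + \<sigma>)"
      unfolding that(2) assms(9) by (simp add: algebra_simps)
    then show ?thesis by (simp only: of_real_minus mult_minus1)
  qed
  have nz: "lam0 \<noteq> 0" if "lam0 \<notin> cball 0 1" for lam0 :: complex
    using that by auto
  note hyperbolic = main[where e = 1 and form = H2_form and k = "1/2", folded H2_eq]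
  note spherical = main[where e = "-1" and form = S2_form and k = "-1/2", folded S2_eq]
  show ?thesis
  proof (intro conjI impI allI; elim conjE)
    fix lam0 assume K: "K < 0" and lam0: "lam0 \<notin> cball 0 1" "cmod lam0 = exp (arcosh (sqrt (- 1 / K)))"
    show "\<exists>h\<in>SL2C. harmonic_into D H2 H2_form (\<lambda>z. h ** gauss_map \<Psi> lam0 z ** matrix_inv h) \<and>
        local_diffeo_into D H2 (\<lambda>z. h ** gauss_map \<Psi> lam0 z ** matrix_inv h)"
      by (rule hyperbolic(1)[OF nz[OF lam0(1)] _ hyp[OF K lam0(2)] H2_form]) auto
    show "non_conformal D H2_form (gauss_map \<Psi> lam0)"
      if "cmod lam = 1" "\<not> totally_umbilic D (assoc_surface \<Psi> lam) (assoc_normal \<Psi> lam)" for lam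
      by (rule hyperbolic(2)[OF nz[OF lam0(1)] _ hyp[OF K lam0(2)] H2_form _ that]) auto
  next
    fix lam0 assume K: "0 < K" and lam0: "lam0 \<notin> cball 0 1" "cmod lam0 = exp (arsinh (sqrt (1 / K)))"
    show "\<exists>h\<in>SL2C. harmonic_into D S2 S2_form (\<lambda>z. h ** gauss_map \<Psi> lam0 z ** matrix_inv h) \<and>
        local_diffeo_into D S2 (\<lambda>z. h ** gauss_map \<Psi> lam0 z ** matrix_inv h)"
      by (rule spherical(1)[OF nz[OF lam0(1)] _ sph[OF K lam0(2)] S2_form]) auto
    show "non_conformal D S2_form (gauss_map \<Psi> lam0)"
      if "cmod lam = 1" "\<not> totally_umbilic D (assoc_surface \<Psi> lam) (assoc_normal \<Psi> lam)" for lam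
      by (rule spherical(2)[OF nz[OF lam0(1)] _ sph[OF K lam0(2)] S2_form _ that]) auto
  qed
qed

end
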